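(* Let $\frac12<\eta<1$ and let $f:(0,1)\times(0,+\infty)\to(-\infty,+\infty)$ be continuous. Suppose: (i) there exist $M>0$, a function $g:(0,1)\to(0,+\infty)$ with $\int_0^{\eta}s g(s)\,ds+\int_\eta^1 g(s)\,ds<+\infty$, and a continuous function $h:(0,+\infty)\to[0,+\infty)$ such that $$0\le M+f(t,x)\le g(t)h(x)\quad\text{for all } t\in(0,1),\ x\in(0,+\infty);$$ (ii) there exists an interval $[\alpha,\beta]\subset(0,1)$, $\alpha<\beta$, such that $$\lim_{x\to0+}f(t,x)=+\infty,\qquad \lim_{x\to+\infty}\frac{f(t,x)}{x}=+\infty,$$ both uniformly with respect to $t\in[\alpha,\beta]$. Then for each $r>0$ there exists $\overline\lambda=\overline\lambda(r)>0$ such that for every $\lambda\in(0,\overline\lambda)$ the boundary value problem $$x'''(t)-\lambda f(t,x(t))=0,\ t\in(0,1);\qquad x(0)=x'(\eta)=x''(1)=0$$ has at least two positive solutions $x$ and $y$ in $C^3((0,1),\mathbb R)\cap C([0,1],\mathbb R)$ satisfying $0<\|x\|<r<\|y\|$.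
   Context: $\|x\|=\max_{t\in[0,1]}|x(t)|$ is the norm of $C([0,1],\mathbb R)$. A function $y\in C([0,1],\mathbb R)$ is called a positive solution of the boundary value problem if it satisfies the boundary value problem (equation and boundary conditions) and $y(t)>0$ for $t\in(0,1]$. The nonlinearity $f$ may be singular at $t=0$, $t=1$ and $x=0$, and may take negative values. *)

theory Defs
  imports "HOL-Analysis.Analysis"
begin

(* x \<in> C^k(S); differentiability at points of S is relative to S, which for open S
   is ordinary differentiability. *)
primrec Ck_on :: "nat \<Rightarrow> real set \<Rightarrow> (real \<Rightarrow> real) \<Rightarrow> bool" where
  "Ck_on 0 S x \<longleftrightarrow> continuous_on S x"
| "Ck_on (Suc k) S x \<longleftrightarrow>
     (\<exists>x'. (\<forall>t\<in>S. (x has_real_derivative x' t) (at t within S)) \<and> Ck_on k S x')"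

(* Maximum norm of C([0,1]). For continuous x the supremum is attained. *)
definition norm01 :: "(real \<Rightarrow> real) \<Rightarrow> real" where
  "norm01 x = (SUP t\<in>{0..1}. \<bar>x t\<bar>)"

(* f t x \<rightarrow> +\<infinity> as x tends along F, uniformly with respect to t \<in> T. *)
definition uniformly_at_top :: "'a set \<Rightarrow> ('a \<Rightarrow> 'b \<Rightarrow> real) \<Rightarrow> 'b filter \<Rightarrow> bool" where
  "uniformly_at_top T f F \<longleftrightarrow> (\<forall>K. \<forall>\<^sub>F x in F. \<forall>t\<in>T. K \<le> f t x)"

(* x''' - lam f(t,x) = 0 on (0,1), x(0) = x'(\<eta>) = x''(1) = 0.
   Only the values of x on [0,1] matter: f may be singular at t = 1, so x''(1) is the
   second derivative from the left, i.e. x1 and x2 are the derivatives relative to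
   (0,1], which are two-sided in the interior and one-sided at 1. *)
definition solves_bvp ::
  "real \<Rightarrow> real \<Rightarrow> (real \<Rightarrow> real \<Rightarrow> real) \<Rightarrow> (real \<Rightarrow> real) \<Rightarrow> bool" where
  "solves_bvp \<eta> lam f x \<longleftrightarrow>
     (\<exists>x1 x2 x3.
        (\<forall>t\<in>{0<..1}. (x has_real_derivative x1 t) (at t within {0<..1})) \<and>
        (\<forall>t\<in>{0<..1}. (x1 has_real_derivative x2 t) (at t within {0<..1})) \<and>
        (\<forall>t\<in>{0<..<1}. (x2 has_real_derivative x3 t) (at t)) \<and>
        (\<forall>t\<in>{0<..<1}. x3 t - lam * f t (x t) = 0) \<and>
        x 0 = 0 \<and> x1 \<eta> = 0 \<and> x2 1 = 0)"

definition positive_solution ::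
  "real \<Rightarrow> real \<Rightarrow> (real \<Rightarrow> real \<Rightarrow> real) \<Rightarrow> (real \<Rightarrow> real) \<Rightarrow> bool" where
  "positive_solution \<eta> lam f x \<longleftrightarrow>
     continuous_on {0..1} x \<and> solves_bvp \<eta> lam f x \<and> (\<forall>t\<in>{0<..1}. 0 < x t)"

end

theory Submission
  imports Defs "HOL-Complex_Analysis.Great_Picard"
begin

text \<open>
  Put \<open>u = x + lam * M * w\<close>, where \<open>w\<close> solves the problem with right-hand side \<open>1\<close>. Then \<open>u\<close> is a fixed point of the
  positive integral operator \<open>T\<close> given by the Green function, \<open>u\<close> attains its maximum at \<open>\<eta>\<close>, and
  \<open>u t \<ge> (2 * \<eta> - 1) * t * u \<eta>\<close>. As \<open>w t \<le> t\<close>, the perturbation is at most half of \<open>u\<close> once \<open>u \<eta>\<close> exceeds a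
  constant times \<open>lam\<close>.

  With \<open>f t x\<close> replaced by \<open>f t (max x d)\<close>, the operator acts on Lipschitz functions and fixed points come
  from Schauder's theorem, itself a consequence of Kuhn's combinatorial lemma and Arzela-Ascoli. For small \<open>lam\<close>
  there is no solution of \<open>u = \<mu> * T u\<close> with \<open>\<mu> \<le> 1\<close> and \<open>u \<eta>\<close> equal to \<open>r / 2\<close> or \<open>2 * r\<close>; there is
  none with \<open>\<mu> \<ge> 1\<close> and \<open>u \<eta>\<close> equal to some large \<open>R\<close> by superlinearity, and fixed points with very small
  \<open>u \<eta>\<close> are excluded by the blow-up of \<open>f\<close> at \<open>x = 0\<close>. This yields one fixed point below \<open>r / 2\<close> and one
  above \<open>2 * r\<close>, with bounds independent of \<open>d\<close>. Since \<open>h\<close> may blow up arbitrarily fast at \<open>0\<close>, the limit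
  \<open>d \<rightarrow> 0\<close> is taken in the equation for \<open>u t - u \<tau>\<close>, whose kernel vanishes for \<open>s \<le> \<tau>\<close>, and equicontinuity at
  \<open>t = 0\<close> is obtained from the time \<open>u\<close> needs to climb from \<open>e / 2\<close> to \<open>e\<close>.
\<close>

section \<open>A Schauder fixed point theorem for Lipschitz functions\<close>

lemma approximate_fixed_point_cube:
  fixes F :: "(nat \<Rightarrow> real) \<Rightarrow> nat \<Rightarrow> real"
  assumes B: "0 < B" and e: "0 < e"
    and maps: "\<And>x i. \<lbrakk>\<And>j. j < n \<Longrightarrow> x j \<in> {0..B}; i < n\<rbrakk> \<Longrightarrow> F x i \<in> {0..B}"
    and unif: "\<And>e. 0 < e \<Longrightarrow> \<exists>d>0. \<forall>x y. (\<forall>j<n. x j \<in> {0..B} \<and> y j \<in> {0..B} \<and> \<bar>x j - y j\<bar> \<le> d)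
                 \<longrightarrow> (\<forall>i<n. \<bar>F x i - F y i\<bar> \<le> e)"
  shows "\<exists>x. (\<forall>j<n. x j \<in> {0..B}) \<and> (\<forall>i<n. \<bar>F x i - x i\<bar> \<le> e)"
proof -
  have e2: "0 < e / 2" using e by simp
  obtain d where d: "d > 0" and dF: "\<And>x y i. \<lbrakk>\<forall>j<n. x j \<in> {0..B} \<and> y j \<in> {0..B} \<and> \<bar>x j - y j\<bar> \<le> d; i < n\<rbrakk>
       \<Longrightarrow> \<bar>F x i - F y i\<bar> \<le> e / 2"
    using unif[OF e2] by blast
  obtain p :: nat where p: "B / min d (e / 2) < real p" using reals_Archimedean2 by blast
  have m: "0 < min d (e / 2)" using d e by simp
  have p0: "0 < real p" using p B m by (meson divide_pos_pos less_trans)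
  have "B < min d (e / 2) * real p" using p by (simp only: pos_divide_less_eq[OF m] mult.commute)
  then have "B / real p < min d (e / 2)" by (rule pos_divide_less_eq[THEN iffD2, OF p0])
  then have Bp: "B / real p \<le> d" "B / real p \<le> e / 2" by auto
  define sc where "sc x j = B * real (x j) / real p" for x :: "nat \<Rightarrow> nat" and j
  have sc: "sc x j \<in> {0..B}" if "x j \<le> p" for x j
    using that p0 B by (auto simp: sc_def field_simps)
  define label where "label x i = (if x i = p \<or> x i \<noteq> 0 \<and> F (sc x) i < sc x i then 1 else 0 :: nat)"
    for x i
  have "0 < p" using p0 by simp
  then obtain q where q: "\<forall>i<n. q i < p"
    and rs: "\<forall>i<n. \<exists>r s. (\<forall>j<n. q j \<le> r j \<and> r j \<le> q j + 1) \<and> (\<forall>j<n. q j \<le> s j \<and> s j \<le> q j + 1) \<and> label r i \<noteq> label s i"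
    by (rule kuhn_lemma[of p n label]) (use p0 in \<open>auto simp: label_def\<close>)
  have near: "\<bar>F (sc r) i - F (sc q) i\<bar> \<le> e / 2" "\<bar>sc r i - sc q i\<bar> \<le> e / 2" "\<forall>j<n. r j \<le> p"
    if r: "\<forall>j<n. q j \<le> r j \<and> r j \<le> q j + 1" and i: "i < n" for r i
  proof -
    have diff: "\<bar>sc r j - sc q j\<bar> \<le> B / real p" if "j < n" for j
    proof -
      have "sc r j - sc q j = (B / real p) * (real (r j) - real (q j))"
        by (simp add: sc_def diff_divide_distrib right_diff_distrib)
      moreover have "\<bar>real (r j) - real (q j)\<bar> \<le> 1" using r that by fastforce
      ultimately show ?thesis using B p0 by (simp add: abs_mult divide_right_mono mult_left_le)
    qed
    show rp: "\<forall>j<n. r j \<le> p" using r q by fastforce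
    show "\<bar>sc r i - sc q i\<bar> \<le> e / 2" using diff[OF i] Bp by linarith
    show "\<bar>F (sc r) i - F (sc q) i\<bar> \<le> e / 2"
      using diff Bp rp q sc by (intro dF i allI impI conjI) (auto intro: order_trans less_imp_le)
  qed
  have "\<bar>F (sc q) i - sc q i\<bar> \<le> e" if i: "i < n" for i
  proof -
    obtain r s where r: "\<forall>j<n. q j \<le> r j \<and> r j \<le> q j + 1" "label r i = 1"
      and s: "\<forall>j<n. q j \<le> s j \<and> s j \<le> q j + 1" "label s i = 0"
      using rs i unfolding label_def by (metis zero_neq_one)
    have "F (sc r) i \<in> {0..B}" "F (sc s) i \<in> {0..B}"
      using near(3)[OF r(1) i] near(3)[OF s(1) i] by (intro maps sc i; blast)+
    then have "F (sc r) i \<le> sc r i" "sc s i \<le> F (sc s) i"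
      using r(2) s(2) p0 by (auto simp: label_def sc_def split: if_splits)
    then show ?thesis using near(1,2)[OF r(1) i] near(1,2)[OF s(1) i] by linarith
  qed
  then show ?thesis using q sc by (intro exI[of _ "sc q"]) (auto intro: less_imp_le)
qed

definition lip_functions :: "real \<Rightarrow> real \<Rightarrow> (real \<Rightarrow> real) set" where
  "lip_functions B L = {u. (\<forall>t\<in>{0..1}. u t \<in> {0..B}) \<and> (\<forall>s\<in>{0..1}. \<forall>t\<in>{0..1}. \<bar>u s - u t\<bar> \<le> L * \<bar>s - t\<bar>)}"

lemma lip_functions_continuous:
  assumes "u \<in> lip_functions B L" shows "continuous_on {0..1} u"
proof -
  have "(max L 0)-lipschitz_on {0..1} u"
  proof (rule lipschitz_onI)
    fix s t :: real assume "s \<in> {0..1}" "t \<in> {0..1}"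
    then have "\<bar>u s - u t\<bar> \<le> L * \<bar>s - t\<bar>" using assms by (auto simp: lip_functions_def)
    also have "\<dots> \<le> max L 0 * \<bar>s - t\<bar>" by (intro mult_right_mono) auto
    finally show "dist (u s) (u t) \<le> max L 0 * dist s t" by (simp add: dist_real_def)
  qed simp
  then show ?thesis by (rule lipschitz_on_continuous_on)
qed

lemma lip_functions_compact:
  assumes u: "\<And>n::nat. u n \<in> lip_functions B L"
  obtains v k where "v \<in> lip_functions B L" "strict_mono (k :: nat \<Rightarrow> nat)"
    "uniform_limit {0..1} (\<lambda>n. u (k n)) v sequentially"
proof -
  have bd: "norm (u n t) \<le> B" if "t \<in> {0..1}" for n t
    using u[of n] that by (fastforce simp: lip_functions_def)
  have lip: "\<bar>u n s - u n t\<bar> \<le> L * \<bar>s - t\<bar>" if "s \<in> {0..1}" "t \<in> {0..1}" for n s t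
    using u[of n] that by (auto simp: lip_functions_def)
  obtain v and k :: "nat \<Rightarrow> nat" where v: "continuous_on {0..1} v" and k: "strict_mono k"
    and lim: "\<And>e. 0 < e \<Longrightarrow> \<exists>N. \<forall>n x. n \<ge> N \<and> x \<in> {0..1} \<longrightarrow> norm (u (k n) x - v x) < e"
  proof (rule Arzela_Ascoli[of "{0..1::real}" u B])
    fix x e :: real assume x: "x \<in> {0..1}" and e: "0 < e"
    have "norm (u n x - u n y) < e" if "y \<in> {0..1}" "norm (x - y) < e / (\<bar>L\<bar> + 1)" for n y
    proof -
      have "\<bar>u n x - u n y\<bar> \<le> L * \<bar>x - y\<bar>" using lip x that by simp
      also have "\<dots> \<le> (\<bar>L\<bar> + 1) * \<bar>x - y\<bar>" by (intro mult_right_mono) auto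
      also have "\<dots> < e" using that(2) by (simp add: field_simps)
      finally show ?thesis by simp
    qed
    then show "\<exists>d>0. \<forall>n y. y \<in> {0..1} \<and> norm (x - y) < d \<longrightarrow> norm (u n x - u n y) < e"
      using e by (intro exI[of _ "e / (\<bar>L\<bar> + 1)"]) auto
  qed (use bd in auto)
  have ul: "uniform_limit {0..1} (\<lambda>n. u (k n)) v sequentially"
  proof (rule uniform_limitI)
    fix e :: real assume "0 < e"
    then obtain N where "\<forall>n x. n \<ge> N \<and> x \<in> {0..1} \<longrightarrow> norm (u (k n) x - v x) < e" using lim by blast
    then show "\<forall>\<^sub>F n in sequentially. \<forall>x\<in>{0..1}. dist (u (k n) x) (v x) < e"
      by (auto simp: eventually_sequentially dist_norm intro!: exI[of _ N])
  qed
  have pt: "(\<lambda>n. u (k n) t) \<longlonglongrightarrow> v t" if "t \<in> {0..1}" for t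
    using tendsto_uniform_limitI[OF ul that] .
  have "v t \<in> {0..B}" if "t \<in> {0..1}" for t
    using u that by (intro closed_sequentially[OF closed_atLeastAtMost _ pt]) (auto simp: lip_functions_def)
  moreover have "\<bar>v s - v t\<bar> \<le> L * \<bar>s - t\<bar>" if "s \<in> {0..1}" "t \<in> {0..1}" for s t
    by (rule LIMSEQ_le_const2[OF tendsto_rabs[OF tendsto_diff[OF pt pt]]]) (use that lip in auto)
  ultimately show ?thesis using that[OF _ k ul] by (auto simp: lip_functions_def)
qed

lemma continuous_imp_uniformly_on_lip_functions:
  assumes cont: "\<And>v u. \<lbrakk>\<And>n::nat. v n \<in> lip_functions B L; u \<in> lip_functions B L;
        uniform_limit {0..1} v u sequentially\<rbrakk> \<Longrightarrow> uniform_limit {0..1} (\<lambda>n. T (v n)) (T u :: real \<Rightarrow> real) sequentially"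
    and e: "0 < e"
  shows "\<exists>d>0. \<forall>u\<in>lip_functions B L. \<forall>v\<in>lip_functions B L. (\<forall>t\<in>{0..1}. \<bar>u t - v t\<bar> \<le> d)
           \<longrightarrow> (\<forall>t\<in>{0..1}. \<bar>T u t - T v t\<bar> \<le> e)"
proof (rule ccontr)
  assume neg: "\<not> ?thesis"
  have "\<exists>u v. u \<in> lip_functions B L \<and> v \<in> lip_functions B L \<and> (\<forall>t\<in>{0..1}. \<bar>u t - v t\<bar> \<le> inverse (real (Suc n))) \<and>
          \<not> (\<forall>t\<in>{0..1}. \<bar>T u t - T v t\<bar> \<le> e)" for n
    using neg by (metis inverse_positive_iff_positive of_nat_0_less_iff zero_less_Suc)
  then obtain u v where u: "\<And>n. u n \<in> lip_functions B L" and v: "\<And>n. v n \<in> lip_functions B L"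
    and uv: "\<And>n t. t \<in> {0..1} \<Longrightarrow> \<bar>u n t - v n t\<bar> \<le> inverse (real (Suc n))"
    and far: "\<And>n. \<not> (\<forall>t\<in>{0..1}. \<bar>T (u n) t - T (v n) t\<bar> \<le> e)"
    by metis
  obtain w k where w: "w \<in> lip_functions B L" and k: "strict_mono k"
    and uw: "uniform_limit {0..1} (\<lambda>n. u (k n)) w sequentially"
    by (rule lip_functions_compact[OF u])
  have vw: "uniform_limit {0..1} (\<lambda>n. v (k n)) w sequentially"
  proof (rule uniform_limitI)
    fix \<epsilon> :: real assume \<epsilon>: "\<epsilon> > 0"
    have "(\<lambda>n. inverse (real (Suc (k n)))) \<longlonglongrightarrow> 0"
      using LIMSEQ_subseq_LIMSEQ[OF LIMSEQ_inverse_real_of_nat k] by (simp add: o_def)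
    then have "\<forall>\<^sub>F n in sequentially. inverse (real (Suc (k n))) < \<epsilon> / 2"
      using \<epsilon> by (intro order_tendstoD) auto
    moreover have "\<forall>\<^sub>F n in sequentially. \<forall>t\<in>{0..1}. dist (u (k n) t) (w t) < \<epsilon> / 2"
      using uniform_limitD[OF uw, of "\<epsilon> / 2"] \<epsilon> by simp
    ultimately show "\<forall>\<^sub>F n in sequentially. \<forall>t\<in>{0..1}. dist (v (k n) t) (w t) < \<epsilon>"
    proof eventually_elim
      case (elim n)
      show ?case
      proof
        fix t :: real assume t: "t \<in> {0..1}"
        show "dist (v (k n) t) (w t) < \<epsilon>"
          using uv[OF t, of "k n"] elim(1) elim(2)[rule_format, OF t] unfolding dist_real_def by linarith
      qed
    qed
  qed
  have "\<forall>\<^sub>F n in sequentially. \<forall>t\<in>{0..1}. dist (T (u (k n)) t) (T w t) < e / 2"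
    "\<forall>\<^sub>F n in sequentially. \<forall>t\<in>{0..1}. dist (T (v (k n)) t) (T w t) < e / 2"
    using uniform_limitD[OF cont[OF u w uw], of "e / 2"] uniform_limitD[OF cont[OF v w vw], of "e / 2"] e
    by simp_all
  then have "\<forall>\<^sub>F n in sequentially. False"
  proof eventually_elim
    case (elim n)
    have "\<bar>T (u (k n)) t - T (v (k n)) t\<bar> \<le> e" if "t \<in> {0..1}" for t
      using elim(1)[rule_format, OF that] elim(2)[rule_format, OF that] unfolding dist_real_def by linarith
    then show ?case using far by blast
  qed
  then show False by simp
qed

text \<open>The McShane extension of the values \<open>v i\<close> at the nodes \<open>i / n\<close>, truncated at \<open>B\<close>. Unlike linear
  interpolation it is \<open>L\<close>-Lipschitz for arbitrary values \<open>v\<close>.\<close>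

definition mcshane :: "real \<Rightarrow> real \<Rightarrow> nat \<Rightarrow> (nat \<Rightarrow> real) \<Rightarrow> real \<Rightarrow> real" where
  "mcshane B L n v t = min B (Min ((\<lambda>i. v i + L * \<bar>t - real i / real n\<bar>) ` {..n}))"

lemma abs_min_Min_diff_le:
  fixes a b :: "nat \<Rightarrow> real"
  assumes "\<And>i. i \<le> n \<Longrightarrow> \<bar>a i - b i\<bar> \<le> e"
  shows "\<bar>min B (Min (a ` {..n})) - min B (Min (b ` {..n}))\<bar> \<le> e"
proof -
  have *: "Min (a ` {..n}) \<le> Min (b ` {..n}) + e" if "\<And>i. i \<le> n \<Longrightarrow> \<bar>a i - b i\<bar> \<le> e" for a b
  proof -
    have "Min (b ` {..n}) \<in> b ` {..n}" by (intro Min_in) auto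
    then obtain i where i: "i \<le> n" "Min (b ` {..n}) = b i" by blast
    have "Min (a ` {..n}) \<le> a i" using i by (intro Min_le) auto
    then show ?thesis using that[of i] i by linarith
  qed
  have "0 \<le> e" using assms[of 0] by linarith
  moreover have "\<And>i. i \<le> n \<Longrightarrow> \<bar>b i - a i\<bar> \<le> e" using assms by (simp add: abs_minus_commute)
  ultimately have "Min (b ` {..n}) \<le> Min (a ` {..n}) + e" by (intro *)
  moreover have "Min (a ` {..n}) \<le> Min (b ` {..n}) + e" by (intro * assms)
  ultimately show ?thesis using \<open>0 \<le> e\<close> by linarith
qed

lemma mcshane_lip:
  assumes "0 \<le> L" "0 \<le> B" "\<And>i. i \<le> n \<Longrightarrow> 0 \<le> v i"
  shows "mcshane B L n v \<in> lip_functions B L"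
proof -
  have "0 \<le> Min ((\<lambda>i. v i + L * \<bar>t - real i / real n\<bar>) ` {..n})" for t
    using assms by (subst Min_ge_iff) auto
  moreover have "\<bar>mcshane B L n v s - mcshane B L n v t\<bar> \<le> L * \<bar>s - t\<bar>" for s t
    unfolding mcshane_def
  proof (rule abs_min_Min_diff_le)
    fix i
    have "\<bar>\<bar>s - real i / real n\<bar> - \<bar>t - real i / real n\<bar>\<bar> \<le> \<bar>s - t\<bar>" by linarith
    from mult_left_mono[OF this assms(1)]
    show "\<bar>v i + L * \<bar>s - real i / real n\<bar> - (v i + L * \<bar>t - real i / real n\<bar>)\<bar> \<le> L * \<bar>s - t\<bar>"
      using assms(1) by (simp add: right_diff_distrib[symmetric] abs_mult)
  qed
  ultimately show ?thesis using assms(2) by (auto simp: lip_functions_def mcshane_def)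
qed

lemma mcshane_approx:
  assumes u: "u \<in> lip_functions B L" and L: "0 \<le> L" and n: "0 < n" and t: "t \<in> {0..1}"
  shows "\<bar>mcshane B L n (\<lambda>i. u (real i / real n)) t - u t\<bar> \<le> 2 * L / real n"
proof -
  let ?S = "(\<lambda>i. u (real i / real n) + L * \<bar>t - real i / real n\<bar>) ` {..n}"
  have node: "real i / real n \<in> {0..1}" if "i \<le> n" for i using that n by (auto simp: field_simps)
  have lip: "\<bar>u t - u (real i / real n)\<bar> \<le> L * \<bar>t - real i / real n\<bar>" if "i \<le> n" for i
    using u node[OF that] t by (auto simp: lip_functions_def)
  have uB: "u t \<le> B" using u t by (auto simp: lip_functions_def)
  have "u t \<le> Min ?S"
  proof (subst Min_ge_iff)
    show "\<forall>a\<in>?S. u t \<le> a" using lip by (auto simp: abs_le_iff diff_le_eq add.commute)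
  qed auto
  moreover have "Min ?S \<le> u t + 2 * L / real n"
  proof -
    define i where "i = nat \<lfloor>t * real n\<rfloor>"
    have i: "real i \<le> t * real n" "t * real n < real i + 1"
    proof -
      have "0 \<le> t * real n" using t by simp
      then show "real i \<le> t * real n" "t * real n < real i + 1"
        unfolding i_def by linarith+
    qed
    have "t * real n \<le> real n" using t by (simp add: mult_left_le_one_le)
    then have in': "i \<le> n" using i(1) by linarith
    have "t - real i / real n = (t * real n - real i) / real n" using n by (simp add: field_simps)
    then have "\<bar>t - real i / real n\<bar> \<le> 1 / real n" using i by (simp add: abs_divide divide_right_mono)
    from mult_left_mono[OF this L] have "L * \<bar>t - real i / real n\<bar> \<le> L / real n" by simp
    moreover have "Min ?S \<le> u (real i / real n) + L * \<bar>t - real i / real n\<bar>"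
      using in' by (intro Min_le) auto
    ultimately show ?thesis using lip[OF in'] by (simp add: abs_le_iff)
  qed
  moreover have "0 \<le> 2 * L / real n" using L by simp
  ultimately show ?thesis using uB unfolding mcshane_def by linarith
qed

theorem schauder_lip_functions:
  assumes B: "0 < B" and L: "0 \<le> L"
    and maps: "\<And>u. u \<in> lip_functions B L \<Longrightarrow> T u \<in> lip_functions B L"
    and cont: "\<And>v u. \<lbrakk>\<And>n::nat. v n \<in> lip_functions B L; u \<in> lip_functions B L;
        uniform_limit {0..1} v u sequentially\<rbrakk> \<Longrightarrow> uniform_limit {0..1} (\<lambda>n. T (v n)) (T u) sequentially"
  shows "\<exists>u\<in>lip_functions B L. \<forall>t\<in>{0..1}. T u t = u t"
proof -
  let ?X = "lip_functions B L"
  have node: "real i / real n \<in> {0..1}" if "i < Suc n" "0 < n" for i n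
    using that by (auto simp: field_simps)
  have appr: "\<exists>u\<in>?X. \<forall>t\<in>{0..1}. \<bar>T u t - u t\<bar> \<le> (2 * L + 1) / real n" if n: "0 < n" for n
  proof -
    let ?E = "mcshane B L n"
    let ?F = "\<lambda>v i. T (?E v) (real i / real n)"
    have EX: "?E v \<in> ?X" if "\<And>j. j < Suc n \<Longrightarrow> v j \<in> {0..B}" for v
      using that by (intro mcshane_lip L) (use B in auto)
    have Ediff: "\<bar>?E v t - ?E w t\<bar> \<le> e" if "\<And>j. j < Suc n \<Longrightarrow> \<bar>v j - w j\<bar> \<le> e" for v w e t
      unfolding mcshane_def by (rule abs_min_Min_diff_le) (use that in \<open>auto simp: less_Suc_eq_le\<close>)
    have "\<exists>v. (\<forall>j<Suc n. v j \<in> {0..B}) \<and> (\<forall>i<Suc n. \<bar>?F v i - v i\<bar> \<le> 1 / real n)"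
    proof (rule approximate_fixed_point_cube[OF B])
      show "0 < 1 / real n" using n by simp
      show "?F x i \<in> {0..B}" if "\<And>j. j < Suc n \<Longrightarrow> x j \<in> {0..B}" "i < Suc n" for x i
        using maps[OF EX[OF that(1)]] node[OF that(2) n] unfolding lip_functions_def by auto
      fix e :: real assume "0 < e"
      then obtain d where d: "d > 0" "\<And>u v t. \<lbrakk>u \<in> ?X; v \<in> ?X; \<forall>t\<in>{0..1}. \<bar>u t - v t\<bar> \<le> d; t \<in> {0..1}\<rbrakk>
            \<Longrightarrow> \<bar>T u t - T v t\<bar> \<le> e"
        using continuous_imp_uniformly_on_lip_functions[of B L T e] cont by blast
      show "\<exists>d>0. \<forall>x y. (\<forall>j<Suc n. x j \<in> {0..B} \<and> y j \<in> {0..B} \<and> \<bar>x j - y j\<bar> \<le> d) \<longrightarrow>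
              (\<forall>i<Suc n. \<bar>?F x i - ?F y i\<bar> \<le> e)"
        
      proof (intro exI[of _ d] conjI allI impI d(1))
        fix x y :: "nat \<Rightarrow> real" and i
        assume xy: "\<forall>j<Suc n. x j \<in> {0..B} \<and> y j \<in> {0..B} \<and> \<bar>x j - y j\<bar> \<le> d" and i: "i < Suc n"
        show "\<bar>?F x i - ?F y i\<bar> \<le> e"
          by (rule d(2)[OF EX EX _ node[OF i n]]) (use xy in \<open>blast intro: Ediff\<close>)+
      qed
    qed
    then obtain v where v: "\<And>j. j < Suc n \<Longrightarrow> v j \<in> {0..B}"
      and Fv: "\<And>i. i < Suc n \<Longrightarrow> \<bar>?F v i - v i\<bar> \<le> 1 / real n" by auto
    let ?u = "T (?E v)"
    have u: "?u \<in> ?X" by (intro maps EX v)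
    have "\<bar>?u t - ?E v t\<bar> \<le> (2 * L + 1) / real n" if t: "t \<in> {0..1}" for t
    proof -
      have "\<bar>?E (\<lambda>i. ?u (real i / real n)) t - ?E v t\<bar> \<le> 1 / real n" by (intro Ediff Fv)
      then show ?thesis using mcshane_approx[OF u L n t] by (simp add: add_divide_distrib)
    qed
    with EX[OF v] show ?thesis by (intro bexI[of _ "?E v"] ballI)
  qed
  have "\<forall>n. \<exists>u. u \<in> ?X \<and> (\<forall>t\<in>{0..1}. \<bar>T u t - u t\<bar> \<le> (2 * L + 1) / real (Suc n))"
    using appr[OF zero_less_Suc] by auto
  then obtain u where "\<forall>n. u n \<in> ?X \<and> (\<forall>t\<in>{0..1}. \<bar>T (u n) t - u n t\<bar> \<le> (2 * L + 1) / real (Suc n))"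
    by (rule choice[THEN exE])
  then have u: "u n \<in> ?X" and Tu: "t \<in> {0..1} \<Longrightarrow> \<bar>T (u n) t - u n t\<bar> \<le> (2 * L + 1) / real (Suc n)" for n t
    by blast+
  obtain w k where w: "w \<in> ?X" and k: "strict_mono k"
    and uw: "uniform_limit {0..1} (\<lambda>n. u (k n)) w sequentially"
    by (rule lip_functions_compact[OF u])
  have "T w t = w t" if t: "t \<in> {0..1}" for t
  proof -
    have 1: "(\<lambda>n. T (u (k n)) t - u (k n) t) \<longlonglongrightarrow> T w t - w t"
      by (intro tendsto_diff tendsto_uniform_limitI[OF cont[OF u w uw] t] tendsto_uniform_limitI[OF uw t])
    have "(\<lambda>n. (2 * L + 1) * inverse (real (Suc (k n)))) \<longlonglongrightarrow> (2 * L + 1) * 0"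
      using LIMSEQ_subseq_LIMSEQ[OF LIMSEQ_inverse_real_of_nat k] by (intro tendsto_mult_left) (simp add: o_def)
    then have 2: "(\<lambda>n. (2 * L + 1) * inverse (real (Suc (k n)))) \<longlonglongrightarrow> 0" by simp
    have "(\<lambda>n. T (u (k n)) t - u (k n) t) \<longlonglongrightarrow> 0"
    proof (rule Lim_null_comparison[OF always_eventually 2], rule allI)
      show "norm (T (u (k n)) t - u (k n) t) \<le> (2 * L + 1) * inverse (real (Suc (k n)))" for n
        using Tu[OF t, of "k n"] unfolding divide_inverse real_norm_def .
    qed
    from LIMSEQ_unique[OF 1 this] show ?thesis by simp
  qed
  then show ?thesis using w by blast
qed

section \<open>The Green function\<close>

definition green :: "real \<Rightarrow> real \<Rightarrow> real \<Rightarrow> real" where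
  "green \<eta> t s = t * min s \<eta> - (t * min s t - (min s t)\<^sup>2 / 2)"

definition green_one :: "real \<Rightarrow> real \<Rightarrow> real" where
  "green_one \<eta> t = t * (\<eta> - \<eta>\<^sup>2 / 2) - t\<^sup>2 / 2 + t ^ 3 / 6"

lemma green_zero: "0 \<le> s \<Longrightarrow> green \<eta> 0 s = 0"
  by (simp add: green_def)

lemma green_eta: "green \<eta> \<eta> s = (min s \<eta>)\<^sup>2 / 2"
  by (simp add: green_def power2_eq_square min_def field_simps)

lemma green_past: "\<lbrakk>s \<le> \<eta>; s \<le> t\<rbrakk> \<Longrightarrow> green \<eta> t s = s\<^sup>2 / 2"
  by (simp add: green_def min_absorb1)

lemma green_future: "t \<le> s \<Longrightarrow> green \<eta> t s = t * min s \<eta> - t\<^sup>2 / 2"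
  by (simp add: green_def min_absorb2 power2_eq_square field_simps)

lemma green_diff_bounds:
  assumes "0 \<le> s" "0 \<le> t" "t \<le> t'"
  shows "(t' - t) * (min s \<eta> - min s t') \<le> green \<eta> t' s - green \<eta> t s"
    and "green \<eta> t' s - green \<eta> t s \<le> (t' - t) * (min s \<eta> - min s t)"
proof -
  define p where "p x = x * min s x - (min s x)\<^sup>2 / 2" for x :: real
  have p: "min s t * (t' - t) \<le> p t' - p t \<and> p t' - p t \<le> min s t' * (t' - t)"
  proof -
    consider "s \<le> t" | "t \<le> s" "s \<le> t'" | "t' \<le> s" by linarith
    then show ?thesis
    proof cases
      case 1
      then show ?thesis using assms by (simp add: p_def min_absorb1 algebra_simps)
    next
      case 2
      have "0 \<le> (s - t) * (t' - (s + t) / 2)" "0 \<le> (s - t)\<^sup>2"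
        using 2 by (auto intro!: mult_nonneg_nonneg)
      then show ?thesis using 2 by (simp add: p_def min_absorb1 min_absorb2 power2_eq_square field_simps)
    next
      case 3
      have "0 \<le> (t' - t)\<^sup>2" by simp
      then show ?thesis using 3 assms(3) by (simp add: p_def min_absorb2 power2_eq_square field_simps)
    qed
  qed
  have "green \<eta> t' s - green \<eta> t s = (t' - t) * min s \<eta> - (p t' - p t)"
    by (simp add: green_def p_def algebra_simps)
  with p show "(t' - t) * (min s \<eta> - min s t') \<le> green \<eta> t' s - green \<eta> t s"
    "green \<eta> t' s - green \<eta> t s \<le> (t' - t) * (min s \<eta> - min s t)"
    by (auto simp: algebra_simps)
qed

lemma continuous_on_green [continuous_intros]:
  "continuous_on S a \<Longrightarrow> continuous_on S (\<lambda>x. green \<eta> t (a x))"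
  unfolding green_def by (intro continuous_intros) auto

context
  fixes \<eta> :: real
  assumes eta: "1 / 2 < \<eta>" "\<eta> < 1"
begin

lemma green_mono:
  assumes "0 \<le> s" "0 \<le> t" "t \<le> t'" "t' \<le> \<eta>"
  shows "green \<eta> t s \<le> green \<eta> t' s"
proof -
  have "0 \<le> (t' - t) * (min s \<eta> - min s t')" using assms by (intro mult_nonneg_nonneg) auto
  then show ?thesis using green_diff_bounds(1)[OF assms(1-3), of \<eta>] by linarith
qed

lemma green_antimono:
  assumes "0 \<le> s" "\<eta> \<le> t" "t \<le> t'"
  shows "green \<eta> t' s \<le> green \<eta> t s"
proof -
  have "(t' - t) * (min s \<eta> - min s t) \<le> 0" using assms by (intro mult_nonneg_nonpos) auto
  then show ?thesis using green_diff_bounds(2)[of s t t' \<eta>] assms eta by linarith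
qed

lemma green_le: "\<lbrakk>0 \<le> s; 0 \<le> t\<rbrakk> \<Longrightarrow> green \<eta> t s \<le> green \<eta> \<eta> s"
  using green_mono[of s t \<eta>] green_antimono[of s \<eta> t] by linarith

lemma green_lipschitz:
  assumes "0 \<le> s" "s \<le> 1" "0 \<le> t" "0 \<le> t'"
  shows "\<bar>green \<eta> t s - green \<eta> t' s\<bar> \<le> \<bar>t - t'\<bar> * min s \<eta>"
proof -
  have *: "\<bar>green \<eta> t' s - green \<eta> t s\<bar> \<le> (t' - t) * min s \<eta>" if t: "0 \<le> t" "t \<le> t'" for t t'
  proof -
    have "(t' - t) * - min s \<eta> \<le> (t' - t) * (min s \<eta> - min s t')"
      using t eta assms by (intro mult_left_mono) (auto simp: min_def)
    moreover have "(t' - t) * (min s \<eta> - min s t) \<le> (t' - t) * min s \<eta>"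
      using t assms by (intro mult_left_mono) auto
    ultimately show ?thesis
      using green_diff_bounds[OF assms(1) t, of \<eta>] unfolding mult_minus_right by linarith
  qed
  show ?thesis using *[of t t'] *[of t' t] assms by (cases "t \<le> t'") (auto simp: abs_minus_commute)
qed

lemma green_ge:
  assumes s: "0 \<le> s" "s \<le> 1" and t: "0 \<le> t" "t \<le> 1"
  shows "(2 * \<eta> - 1) * t * green \<eta> \<eta> s \<le> green \<eta> t s"
proof -
  define m where "m = min s \<eta>"
  have m: "0 \<le> m" "m \<le> 1" using s eta by (auto simp: m_def)
  then have mm: "m * m \<le> m" by (simp add: mult_left_le)
  have c: "0 \<le> 2 * \<eta> - 1" "2 * \<eta> - 1 \<le> 1" using eta by auto
  then have ct: "(2 * \<eta> - 1) * t \<le> t" "0 \<le> (2 * \<eta> - 1) * t" "(2 * \<eta> - 1) * t \<le> 2 * \<eta> - 1"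
    using t by (auto simp: mult_left_le mult_left_le_one_le)
  have peak: "green \<eta> \<eta> s = m\<^sup>2 / 2" by (simp add: green_eta m_def)
  have m2: "0 \<le> m\<^sup>2 / 2" "m\<^sup>2 / 2 \<le> 1 / 2" using m by (auto simp: power2_eq_square mult_le_one)
  show ?thesis
  proof (cases "t \<le> \<eta>")
    case True
    show ?thesis
    proof (cases "t \<le> s")
      case ts: True
      then have "t \<le> m" using True by (simp add: m_def)
      then have "t * (m\<^sup>2 / 2) \<le> t * (m - t / 2)"
        using mm t by (intro mult_left_mono) (auto simp: power2_eq_square)
      moreover have "green \<eta> t s = t * (m - t / 2)"
        using green_future[OF ts, of \<eta>] by (simp add: m_def power2_eq_square algebra_simps)
      moreover have "(2 * \<eta> - 1) * t * (m\<^sup>2 / 2) \<le> t * (m\<^sup>2 / 2)" using ct m2 by (intro mult_right_mono) auto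
      ultimately show ?thesis unfolding peak by linarith
    next
      case False
      then have "green \<eta> t s = m\<^sup>2 / 2" using True by (subst green_past) (auto simp: m_def min_absorb1)
      moreover have "(2 * \<eta> - 1) * t * (m\<^sup>2 / 2) \<le> 1 * (m\<^sup>2 / 2)"
        using ct t m2 by (intro mult_right_mono) auto
      ultimately show ?thesis unfolding peak by simp
    qed
  next
    case False
    have "(2 * \<eta> - 1) * t * (m\<^sup>2 / 2) \<le> green \<eta> 1 s"
    proof (cases "s \<le> \<eta>")
      case True
      have "(2 * \<eta> - 1) * t * (m\<^sup>2 / 2) \<le> 1 * (m\<^sup>2 / 2)"
        using ct t m2 by (intro mult_right_mono) auto
      then show ?thesis using True eta by (subst green_past) (auto simp: m_def min_absorb1)
    next
      case False
      have "(2 * \<eta> - 1) * t * (m\<^sup>2 / 2) \<le> (2 * \<eta> - 1) * (1 / 2)"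
        using ct c m2 by (intro mult_mono) auto
      also have "\<dots> \<le> \<eta> - s + s\<^sup>2 / 2"
        using zero_le_power2[of "1 - s"] by (simp add: power2_eq_square field_simps)
      also have "\<dots> = green \<eta> 1 s" using False s by (simp add: green_def min_absorb1 min_absorb2)
      finally show ?thesis .
    qed
    also have "green \<eta> 1 s \<le> green \<eta> t s" using False s t by (intro green_antimono) auto
    finally show ?thesis unfolding peak .
  qed
qed

lemma green_one_bounds:
  assumes "0 \<le> t" "t \<le> 1"
  shows "0 \<le> green_one \<eta> t" "green_one \<eta> t \<le> t"
proof -
  have eq: "green_one \<eta> t = t * (\<eta> - \<eta>\<^sup>2 / 2 - t / 2 + t\<^sup>2 / 6)"
    by (simp add: green_one_def power2_eq_square power3_eq_cube algebra_simps)
  have e: "3 / 8 \<le> \<eta> - \<eta>\<^sup>2 / 2"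
  proof -
    have "0 \<le> (\<eta> - 1 / 2) * (3 / 2 - \<eta>)" using eta by (intro mult_nonneg_nonneg) auto
    then show ?thesis by (simp add: power2_eq_square field_simps)
  qed
  have "0 \<le> (1 - t) * (2 - t)" using assms by (intro mult_nonneg_nonneg) auto
  then have "t / 2 - t\<^sup>2 / 6 \<le> 1 / 3" by (simp add: power2_eq_square field_simps)
  then show "0 \<le> green_one \<eta> t" unfolding eq using e assms by (intro mult_nonneg_nonneg) auto
  have "t\<^sup>2 \<le> t" using assms by (simp add: power2_eq_square mult_left_le)
  moreover have "0 \<le> \<eta>\<^sup>2" by simp
  ultimately have "\<eta> - \<eta>\<^sup>2 / 2 - t / 2 + t\<^sup>2 / 6 \<le> 1" using eta assms by linarith
  then show "green_one \<eta> t \<le> t" unfolding eq using assms by (simp add: mult_left_le)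
qed

end

lemma indefinite_integral_has_real_derivative_interior:
  fixes q :: "real \<Rightarrow> real"
  assumes "q integrable_on {a..b}" "t \<in> {a<..<b}" "isCont q t"
  shows "((\<lambda>x. integral {a..x} q) has_real_derivative q t) (at t)"
proof -
  have "((\<lambda>x. integral {a..x} q) has_vector_derivative q t) (at t within {a..b} - {})"
    using assms by (intro integral_has_vector_derivative_continuous_at) (auto intro: continuous_at_imp_continuous_at_within)
  moreover have "at t within {a..b} = at t" using assms(2) by (intro at_within_interior) auto
  ultimately show ?thesis by (simp add: has_real_derivative_iff_has_vector_derivative)
qed

lemma equal_derivatives_imp_eq:
  fixes p q :: "real \<Rightarrow> real"
  assumes "a < b" "continuous_on {a..b} p" "continuous_on {a..b} q"
    and "\<And>x. \<lbrakk>a < x; x < b\<rbrakk> \<Longrightarrow> DERIV p x :> r x" "\<And>x. \<lbrakk>a < x; x < b\<rbrakk> \<Longrightarrow> DERIV q x :> r x"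
    and c: "c \<in> {a..b}" "p c = q c" and x: "x \<in> {a..b}"
  shows "p x = q x"
proof -
  have eq: "p x - q x = p a - q a" if "x \<in> {a..b}" for x
  proof (rule DERIV_isconst2[of a b "\<lambda>x. p x - q x"])
    show "DERIV (\<lambda>x. p x - q x) x :> 0" if "a < x" "x < b" for x
      using DERIV_diff[OF assms(4,5)[OF that]] by simp
  qed (use assms that in \<open>auto intro!: continuous_intros\<close>)
  show ?thesis using eq[OF x] eq[OF c(1)] c(2) by simp
qed

lemma green_integral_eq:
  fixes F :: "real \<Rightarrow> real"
  assumes \<eta>: "\<eta> < 1" and \<tau>: "0 < \<tau>" "\<tau> \<le> \<eta>"
    and F: "continuous_on {0<..<1} F"
    and int: "\<And>k. continuous_on {\<tau>..1} k \<Longrightarrow> (\<lambda>s. k s * F s) integrable_on {\<tau>..1}"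
    and t: "t \<in> {\<tau>..1}"
  defines "V \<equiv> \<lambda>t. integral {t..1} F"
  shows "integral {0<..<1} (\<lambda>s. (green \<eta> t s - green \<eta> \<tau> s) * F s)
    = integral {\<tau>..t} (\<lambda>t. integral {t..1} V - integral {\<eta>..1} V)"
proof -
  have \<tau>1: "\<tau> < 1" using \<tau> \<eta> by simp
  have Fc: "isCont F t" if "t \<in> {\<tau><..<1}" for t
    using F that \<tau> by (intro continuous_on_interior[OF F]) auto
  define I where "I k t = integral {\<tau>..t} (\<lambda>s. k s * F s)" for k t
  have I_cont: "continuous_on {\<tau>..1} (I k)" if "continuous_on {\<tau>..1} k" for k
    unfolding I_def by (intro indefinite_integral_continuous_1 int that)
  have I_deriv: "DERIV (I k) t :> k t * F t" if "continuous_on {\<tau>..1} k" "\<tau> < t" "t < 1" for k t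
    unfolding I_def
  proof (rule indefinite_integral_has_real_derivative_interior[OF int[OF that(1)]])
    have "isCont k t" using that by (intro continuous_on_interior[OF that(1)]) auto
    then show "isCont (\<lambda>s. k s * F s) t" using Fc[of t] that by (intro continuous_intros) auto
  qed (use that in auto)
  have F1: "F integrable_on {\<tau>..1}" using int[of "\<lambda>_. 1"] by simp
  have V: "V t = I (\<lambda>_. 1) 1 - I (\<lambda>_. 1) t" if "t \<in> {\<tau>..1}" for t
    using Henstock_Kurzweil_Integration.integral_combine[OF _ _ F1, of t] that by (simp add: V_def I_def)
  have V_cont: "continuous_on {\<tau>..1} V"
    unfolding V_def by (intro indefinite_integral_continuous_1' F1)
  have V_deriv: "DERIV V t :> - F t" if "\<tau> < t" "t < 1" for t
  proof (rule has_field_derivative_transform_within_open[of "\<lambda>t. I (\<lambda>_. 1) 1 - I (\<lambda>_. 1) t" _ _ "{\<tau><..<1}"])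
    show "DERIV (\<lambda>t. I (\<lambda>_. 1) 1 - I (\<lambda>_. 1) t) t :> - F t"
      by (rule derivative_eq_intros I_deriv refl that continuous_intros | simp)+
  qed (use that V in auto)
  define y where "y = (\<lambda>t. integral {t..1} V - integral {\<eta>..1} V)"
  have y_within: "(y has_real_derivative - V t) (at t within {\<tau>..1})" if "t \<in> {\<tau>..1}" for t
    unfolding y_def by (rule derivative_eq_intros integral_has_real_derivative'[OF V_cont that] | simp)+
  have y_cont: "continuous_on {\<tau>..1} y"
    by (rule DERIV_continuous_on[OF y_within])
  have y_deriv: "DERIV y t :> - V t" if "\<tau> < t" "t < 1" for t
    using y_within[of t] that at_within_interior[of t "{\<tau>..1}"] by simp
  define m where "m s = min s \<eta>" for s
  have m: "continuous_on {\<tau>..1} m" unfolding m_def by (intro continuous_intros)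
  have id: "continuous_on {\<tau>..1} (\<lambda>s. s)" "continuous_on {\<tau>..1} (\<lambda>s. s\<^sup>2 / 2)" by (auto intro!: continuous_intros)
  define A where "A = I m 1"
  define y' where "y' t = A - I (\<lambda>s. s) t - t * V t" for t
  have "y x = y' x" if "x \<in> {\<tau>..1}" for x
  proof (rule equal_derivatives_imp_eq[OF \<tau>1 y_cont _ y_deriv _ _ _ that])
    show "continuous_on {\<tau>..1} y'" unfolding y'_def by (intro continuous_intros I_cont id V_cont)
    show "DERIV y' x :> - V x" if "\<tau> < x" "x < 1" for x
      unfolding y'_def by (rule derivative_eq_intros I_deriv V_deriv refl that id | simp)+
    show "\<eta> \<in> {\<tau>..1}" using \<tau> \<eta> by simp
    have "A = I m \<eta> + integral {\<eta>..1} (\<lambda>s. m s * F s)"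
      using Henstock_Kurzweil_Integration.integral_combine[OF _ _ int[OF m], of \<eta>] \<tau> \<eta> by (simp add: A_def I_def)
    also have "I m \<eta> = I (\<lambda>s. s) \<eta>"
      unfolding I_def by (rule Henstock_Kurzweil_Integration.integral_cong) (simp add: m_def)
    also have "integral {\<eta>..1} (\<lambda>s. m s * F s) = integral {\<eta>..1} (\<lambda>s. \<eta> * F s)"
      by (rule Henstock_Kurzweil_Integration.integral_cong) (simp add: m_def)
    also have "\<dots> = \<eta> * V \<eta>" by (simp add: V_def)
    finally show "y \<eta> = y' \<eta>" by (simp add: y_def y'_def)
  qed
  note yy' = this
  define \<Phi> where "\<Phi> t = (t - \<tau>) * A - t * I (\<lambda>s. s) t + I (\<lambda>s. s\<^sup>2 / 2) t - t\<^sup>2 / 2 * V t + \<tau>\<^sup>2 / 2 * V \<tau>" for t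
  have "integral {0<..<1} (\<lambda>s. (green \<eta> t s - green \<eta> \<tau> s) * F s) = \<Phi> t"
  proof -
    let ?G = "\<lambda>s. (green \<eta> t s - green \<eta> \<tau> s) * F s"
    define p where "p s = t * min s t - (min s t)\<^sup>2 / 2" for s
    have p: "continuous_on {\<tau>..1} p" unfolding p_def by (intro continuous_intros) auto
    have "integral {0<..<1} ?G = integral {0..1} ?G"
      by (simp add: integral_open_interval_real)
    also have "\<dots> = integral {\<tau>..1} ?G"
    proof (rule integral_unique, rule has_integral_combine[of 0 \<tau> 1 ?G 0, simplified])
      show "(?G has_integral 0) {0..\<tau>}"
        by (rule has_integral_is_0) (use \<tau> t in \<open>auto simp: green_past\<close>)
      show "(?G has_integral integral {\<tau>..1} ?G) {\<tau>..1}"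
        by (intro integrable_integral int continuous_intros)
    qed (use \<tau> \<tau>1 in auto)
    also have "\<dots> = integral {\<tau>..1} (\<lambda>s. (t - \<tau>) * (m s * F s) + \<tau>\<^sup>2 / 2 * F s - p s * F s)"
      by (rule Henstock_Kurzweil_Integration.integral_cong)
        (simp add: green_def m_def p_def min_absorb2 power2_eq_square field_simps)
    also have "\<dots> = (t - \<tau>) * A + \<tau>\<^sup>2 / 2 * V \<tau> - I p 1"
    proof -
      have "(\<lambda>s. (t - \<tau>) * (m s * F s)) integrable_on {\<tau>..1}" "(\<lambda>s. \<tau>\<^sup>2 / 2 * F s) integrable_on {\<tau>..1}"
        by (intro integrable_on_mult_right int m F1)+
      then show ?thesis
        by (simp add: Henstock_Kurzweil_Integration.integral_diff Henstock_Kurzweil_Integration.integral_add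
            integrable_add int[OF p] A_def I_def V_def)
    qed
    also have "I p 1 = I p t + integral {t..1} (\<lambda>s. p s * F s)"
      using Henstock_Kurzweil_Integration.integral_combine[OF _ _ int[OF p], of t] t by (simp add: I_def)
    also have "I p t = integral {\<tau>..t} (\<lambda>s. t * (s * F s) - s\<^sup>2 / 2 * F s)"
      unfolding I_def by (rule Henstock_Kurzweil_Integration.integral_cong) (simp add: p_def algebra_simps)
    also have "\<dots> = t * I (\<lambda>s. s) t - I (\<lambda>s. s\<^sup>2 / 2) t"
    proof -
      have "(\<lambda>s. s * F s) integrable_on {\<tau>..t}" "(\<lambda>s. s\<^sup>2 / 2 * F s) integrable_on {\<tau>..t}"
        using t integrable_subinterval_real[OF int[OF id(1)], of \<tau> t]
          integrable_subinterval_real[OF int[OF id(2)], of \<tau> t] by auto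
      then show ?thesis
        by (simp add: Henstock_Kurzweil_Integration.integral_diff integrable_on_mult_right I_def)
    qed
    also have "integral {t..1} (\<lambda>s. p s * F s) = integral {t..1} (\<lambda>s. t\<^sup>2 / 2 * F s)"
      by (rule Henstock_Kurzweil_Integration.integral_cong) (simp add: p_def min_absorb2 power2_eq_square)
    also have "\<dots> = t\<^sup>2 / 2 * V t" by (simp add: V_def)
    finally show ?thesis by (simp add: \<Phi>_def)
  qed
  also have "\<dots> = integral {\<tau>..t} y"
  proof (rule equal_derivatives_imp_eq[OF \<tau>1 _ _ _ _ _ _ t])
    show "continuous_on {\<tau>..1} \<Phi>" unfolding \<Phi>_def by (intro continuous_intros I_cont id V_cont) auto
    show "continuous_on {\<tau>..1} (\<lambda>t. integral {\<tau>..t} y)"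
      by (intro indefinite_integral_continuous_1 integrable_continuous_interval y_cont)
    show "DERIV (\<lambda>t. integral {\<tau>..t} y) x :> y x" if "\<tau> < x" "x < 1" for x
      using that y_cont by (intro indefinite_integral_has_real_derivative_interior[of _ _ 1] continuous_on_interior[OF y_cont]
          integrable_continuous_interval) auto
    show "DERIV \<Phi> x :> y x" if x: "\<tau> < x" "x < 1" for x
    proof -
      have "DERIV \<Phi> x :> A - (I (\<lambda>s. s) x + x * (x * F x)) + x\<^sup>2 / 2 * F x - (x * V x + x\<^sup>2 / 2 * - F x)"
        unfolding \<Phi>_def by (rule derivative_eq_intros I_deriv V_deriv refl x id | simp)+
      also have "A - (I (\<lambda>s. s) x + x * (x * F x)) + x\<^sup>2 / 2 * F x - (x * V x + x\<^sup>2 / 2 * - F x) = y x"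
        using yy'[of x] x by (simp add: y'_def power2_eq_square)
      finally show ?thesis .
    qed
    show "\<tau> \<in> {\<tau>..1}" using \<tau>1 by simp
    show "\<Phi> \<tau> = integral {\<tau>..\<tau>} y" by (simp add: \<Phi>_def I_def)
  qed
  finally show ?thesis by (simp add: y_def)
qed

section \<open>The regularised integral operator\<close>

locale singular_bvp =
  fixes f :: "real \<Rightarrow> real \<Rightarrow> real" and g h :: "real \<Rightarrow> real" and \<eta> M \<alpha> \<beta> :: real
  assumes eta: "1 / 2 < \<eta>" "\<eta> < 1"
    and f_cont: "continuous_on ({0<..<1} \<times> {0<..}) (\<lambda>(t, x). f t x)"
    and M_pos: "0 < M"
    and g_pos: "\<And>t. t \<in> {0<..<1} \<Longrightarrow> 0 < g t"
    and g_int: "(\<lambda>s. min s \<eta> * g s) integrable_on {0<..<1}"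
    and h_cont: "continuous_on {0<..} h"
    and f_bounds: "\<And>t x. t \<in> {0<..<1} \<Longrightarrow> 0 < x \<Longrightarrow> 1 \<le> M + f t x \<and> M + f t x \<le> g t * h x"
    and alpha_beta: "0 < \<alpha>" "\<alpha> < \<beta>" "\<beta> < 1"
    and lim_0: "uniformly_at_top {\<alpha>..\<beta>} f (at_right 0)"
    and lim_inf: "uniformly_at_top {\<alpha>..\<beta>} (\<lambda>t x. f t x / x) at_top"
begin

definition \<Gamma> :: real where "\<Gamma> = integral {0<..<1} (\<lambda>s. min s \<eta> * g s)"

definition \<kappa> :: real where "\<kappa> = (\<beta> - \<alpha>) * ((min \<alpha> \<eta>)\<^sup>2 / 2)"

definition c0 :: real where "c0 = 2 * \<eta> - 1"

text \<open>\<open>green_one \<eta>\<close> solves the boundary value problem with right-hand side \<open>1\<close>, so \<open>shift lam u\<close> satisfies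
  the original equation as soon as \<open>u\<close> has third derivative \<open>lam * (M + f t (shift lam u t))\<close>. The
  parameter \<open>d\<close> below cuts off the singularity of \<open>f\<close> at \<open>x = 0\<close>.\<close>

definition shift :: "real \<Rightarrow> (real \<Rightarrow> real) \<Rightarrow> real \<Rightarrow> real" where
  "shift lam u t = u t - lam * M * green_one \<eta> t"

definition reg :: "real \<Rightarrow> real \<Rightarrow> (real \<Rightarrow> real) \<Rightarrow> real \<Rightarrow> real" where
  "reg lam d u s = max (shift lam u s) d"

definition T :: "real \<Rightarrow> real \<Rightarrow> (real \<Rightarrow> real) \<Rightarrow> real \<Rightarrow> real" where
  "T lam d u t = lam * integral {0<..<1} (\<lambda>s. green \<eta> t s * (M + f s (reg lam d u s)))"

lemma c0: "0 < c0" "c0 \<le> 1"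
  using eta by (auto simp: c0_def)

lemma kappa_pos: "0 < \<kappa>"
  using alpha_beta eta unfolding \<kappa>_def by (intro mult_pos_pos) auto

lemma Gamma_nonneg: "0 \<le> \<Gamma>"
  unfolding \<Gamma>_def using eta g_pos
  by (intro integral_nonneg g_int) (auto intro!: mult_nonneg_nonneg intro: less_imp_le)

lemma h_bounded:
  assumes "0 < a" obtains H where "0 < H" "\<And>x. x \<in> {a..b} \<Longrightarrow> h x \<le> H"
proof -
  have "continuous_on {a..b} h" using assms by (intro continuous_on_subset[OF h_cont]) auto
  then have "bounded (h ` {a..b})" by (intro compact_imp_bounded compact_continuous_image) auto
  then obtain H where "\<And>x. x \<in> {a..b} \<Longrightarrow> \<bar>h x\<bar> \<le> H" unfolding bounded_iff by force
  then show ?thesis by (intro that[of "max H 1"]) (fastforce simp: max_def)+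
qed

lemma f_comp_continuous:
  assumes "continuous_on {0<..<1} x" "\<And>s. s \<in> {0<..<1} \<Longrightarrow> 0 < x s"
  shows "continuous_on {0<..<1} (\<lambda>s. f s (x s))"
proof -
  have "continuous_on {0<..<1} (\<lambda>s. (s, x s))" using assms by (intro continuous_intros)
  from continuous_on_compose2[OF f_cont this] show ?thesis using assms(2) by (simp add: image_subset_iff)
qed

lemma f_isCont:
  assumes "s \<in> {0<..<1}" "0 < x" shows "isCont (f s) x"
proof -
  have "continuous_on {0<..} (\<lambda>x. (s, x))" by (intro continuous_intros)
  from continuous_on_compose2[OF f_cont this] have "continuous_on {0<..} (f s)" using assms by (simp add: image_subset_iff)
  then show ?thesis using assms by (simp add: continuous_on_eq_continuous_at)
qed

lemma kernel_integral:
  assumes x: "continuous_on {0<..<1} x" "\<And>s. s \<in> {0<..<1} \<Longrightarrow> 0 < x s"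
    and k: "continuous_on {0<..<1} k" and C: "0 \<le> C" "0 \<le> H"
    and bd: "\<And>s. s \<in> {0<..<1} \<Longrightarrow> k s = 0 \<or> \<bar>k s\<bar> \<le> C * min s \<eta> \<and> h (x s) \<le> H"
  shows "(\<lambda>s. k s * (M + f s (x s))) integrable_on {0<..<1}"
    and "\<bar>integral {0<..<1} (\<lambda>s. k s * (M + f s (x s)))\<bar> \<le> C * H * \<Gamma>"
    and "s \<in> {0<..<1} \<Longrightarrow> \<bar>k s * (M + f s (x s))\<bar> \<le> C * H * (min s \<eta> * g s)"
proof -
  have le: "\<bar>k s * (M + f s (x s))\<bar> \<le> C * H * (min s \<eta> * g s)" if s: "s \<in> {0<..<1}" for s
  proof (cases "k s = 0")
    case True
    then show ?thesis using s C eta g_pos[OF s] by (auto intro!: mult_nonneg_nonneg)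
  next
    case False
    then have b: "\<bar>k s\<bar> \<le> C * min s \<eta>" "h (x s) \<le> H" using bd[OF s] by auto
    have F: "1 \<le> M + f s (x s)" "M + f s (x s) \<le> g s * h (x s)" using f_bounds[OF s x(2)[OF s]] by auto
    have "M + f s (x s) \<le> g s * H" using F(2) mult_left_mono[OF b(2) less_imp_le[OF g_pos[OF s]]] by linarith
    then have "\<bar>k s\<bar> * (M + f s (x s)) \<le> C * min s \<eta> * (g s * H)"
      using b F s eta C by (intro mult_mono) auto
    then show ?thesis using F by (simp add: abs_mult mult.assoc mult.left_commute mult.commute)
  qed
  then show "s \<in> {0<..<1} \<Longrightarrow> \<bar>k s * (M + f s (x s))\<bar> \<le> C * H * (min s \<eta> * g s)" by blast
  have int: "(\<lambda>s. C * H * (min s \<eta> * g s)) integrable_on {0<..<1}"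
    using integrable_on_mult_right[OF g_int, of "C * H"] by simp
  have "continuous_on {0<..<1} (\<lambda>s. k s * (M + f s (x s)))"
    by (intro continuous_intros k f_comp_continuous x)
  then have meas: "(\<lambda>s. k s * (M + f s (x s))) \<in> borel_measurable (lebesgue_on {0<..<1})"
    by (intro continuous_imp_measurable_on_sets_lebesgue) auto
  show i: "(\<lambda>s. k s * (M + f s (x s))) integrable_on {0<..<1}"
    by (rule measurable_bounded_by_integrable_imp_integrable[OF meas int]) (use le in auto)
  have "\<bar>integral {0<..<1} (\<lambda>s. k s * (M + f s (x s)))\<bar> \<le> integral {0<..<1} (\<lambda>s. C * H * (min s \<eta> * g s))"
    using integral_norm_bound_integral[OF i int] le by simp
  then show "\<bar>integral {0<..<1} (\<lambda>s. k s * (M + f s (x s)))\<bar> \<le> C * H * \<Gamma>"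
    by (simp add: \<Gamma>_def)
qed

lemma continuous_on_shift:
  "continuous_on S u \<Longrightarrow> continuous_on S (shift lam u)"
  unfolding shift_def green_one_def by (intro continuous_intros) auto

lemma continuous_on_reg: "continuous_on {0..1} u \<Longrightarrow> continuous_on {0<..<1} (reg lam d u)"
  unfolding reg_def by (intro continuous_intros continuous_on_shift) (erule continuous_on_subset, auto)

lemma shift_le: "\<lbrakk>0 \<le> lam; t \<in> {0..1}\<rbrakk> \<Longrightarrow> shift lam u t \<le> u t"
  using green_one_bounds[OF eta, of t] M_pos by (simp add: shift_def)

lemma shift_ge: "\<lbrakk>0 \<le> lam; t \<in> {0..1}\<rbrakk> \<Longrightarrow> u t - lam * M * t \<le> shift lam u t"
  using green_one_bounds[OF eta, of t] M_pos by (auto simp: shift_def intro!: mult_left_mono)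

lemma reg_bounds:
  assumes "0 \<le> lam" "0 < d" "t \<in> {0..1}" "u t \<le> B"
  shows "d \<le> reg lam d u t" "reg lam d u t \<le> max B d" "0 < reg lam d u t"
  using shift_le[of lam t u] assms by (auto simp: reg_def)

context
  fixes lam d B H :: real and u :: "real \<Rightarrow> real"
  assumes lam: "0 < lam" and d: "0 < d"
    and u: "continuous_on {0..1} u" "\<And>t. t \<in> {0..1} \<Longrightarrow> u t \<le> B"
    and H: "\<And>x. x \<in> {d..max B d} \<Longrightarrow> h x \<le> H"
begin

lemma reg_facts:
  assumes "s \<in> {0<..<1}"
  shows "0 < reg lam d u s" "h (reg lam d u s) \<le> H" "1 \<le> M + f s (reg lam d u s)"
    and "M + f s (reg lam d u s) \<le> g s * H"
proof -
  have s: "s \<in> {0..1}" using assms by auto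
  note r = reg_bounds[of lam d s u B, OF _ d s u(2)[OF s]]
  show p: "0 < reg lam d u s" and hH: "h (reg lam d u s) \<le> H" using r lam by (auto intro!: H)
  show "1 \<le> M + f s (reg lam d u s)" using f_bounds[OF assms p] by auto
  show "M + f s (reg lam d u s) \<le> g s * H"
    using f_bounds[OF assms p] mult_left_mono[OF hH less_imp_le[OF g_pos[OF assms]]] by linarith
qed

lemma H_nonneg: "0 \<le> H"
proof -
  have "1 / 2 \<in> {0<..<1::real}" by simp
  then have "0 < g (1/2) * H" "0 < g (1/2)" using reg_facts(3,4)[of "1/2"] g_pos by force+
  then show ?thesis by (simp add: zero_less_mult_iff)
qed

lemma green_integrable:
  assumes "t \<in> {0..1}"
  shows "(\<lambda>s. green \<eta> t s * (M + f s (reg lam d u s))) integrable_on {0<..<1}"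
proof (rule kernel_integral(1)[of _ _ 1 H])
  show "\<And>s. s \<in> {0<..<1} \<Longrightarrow> green \<eta> t s = 0 \<or> \<bar>green \<eta> t s\<bar> \<le> 1 * min s \<eta> \<and> h (reg lam d u s) \<le> H"
  proof -
    fix s :: real assume s: "s \<in> {0<..<1}"
    have "\<bar>green \<eta> t s - green \<eta> 0 s\<bar> \<le> \<bar>t - 0\<bar> * min s \<eta>"
      using s assms by (intro green_lipschitz[OF eta]) auto
    also have "\<dots> \<le> 1 * min s \<eta>" using s assms eta by (intro mult_right_mono) auto
    finally show "green \<eta> t s = 0 \<or> \<bar>green \<eta> t s\<bar> \<le> 1 * min s \<eta> \<and> h (reg lam d u s) \<le> H"
      using s reg_facts(2)[OF s] by (simp add: green_zero)
  qed
qed (use H_nonneg reg_facts in \<open>auto intro!: continuous_on_reg u continuous_intros\<close>)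

lemma T_diff:
  assumes "t \<in> {0..1}" "t' \<in> {0..1}"
  shows "T lam d u t - T lam d u t' = lam * integral {0<..<1} (\<lambda>s. (green \<eta> t s - green \<eta> t' s) * (M + f s (reg lam d u s)))"
  unfolding T_def left_diff_distrib
  using green_integrable[OF assms(1)] green_integrable[OF assms(2)]
  by (subst Henstock_Kurzweil_Integration.integral_diff) (auto simp: algebra_simps)

lemma T_lipschitz:
  assumes "t \<in> {0..1}" "t' \<in> {0..1}"
  shows "\<bar>T lam d u t - T lam d u t'\<bar> \<le> lam * (H * \<Gamma>) * \<bar>t - t'\<bar>"
proof -
  have "\<bar>integral {0<..<1} (\<lambda>s. (green \<eta> t s - green \<eta> t' s) * (M + f s (reg lam d u s)))\<bar> \<le> \<bar>t - t'\<bar> * H * \<Gamma>"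
    by (rule kernel_integral(2))
      (use H_nonneg reg_facts assms in \<open>auto intro!: continuous_on_reg u continuous_intros green_lipschitz[OF eta]\<close>)
  then show ?thesis unfolding T_diff[OF assms] using lam
    by (simp add: abs_mult mult.assoc mult.left_commute mult.commute)
qed

lemma T_mono_kernel:
  assumes "t \<in> {0..1}" "t' \<in> {0..1}" and "\<And>s. s \<in> {0<..<1} \<Longrightarrow> c * green \<eta> t s \<le> green \<eta> t' s"
  shows "c * T lam d u t \<le> T lam d u t'"
proof -
  have "integral {0<..<1} (\<lambda>s. c * (green \<eta> t s * (M + f s (reg lam d u s)))) \<le>
        integral {0<..<1} (\<lambda>s. green \<eta> t' s * (M + f s (reg lam d u s)))"
  proof (rule integral_le)
    show "(\<lambda>s. c * (green \<eta> t s * (M + f s (reg lam d u s)))) integrable_on {0<..<1}"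
      using integrable_on_mult_right[OF green_integrable[OF assms(1)]] by simp
    fix s :: real assume s: "s \<in> {0<..<1}"
    then show "c * (green \<eta> t s * (M + f s (reg lam d u s))) \<le> green \<eta> t' s * (M + f s (reg lam d u s))"
      unfolding mult.assoc[symmetric] using assms(3)[OF s] reg_facts(3)[OF s] by (intro mult_right_mono) auto
  qed (rule green_integrable[OF assms(2)])
  then show ?thesis using lam by (simp add: T_def mult.left_commute)
qed

lemma T_zero: "T lam d u 0 = 0"
proof -
  have "integral {0<..<1} (\<lambda>s. green \<eta> 0 s * (M + f s (reg lam d u s))) = integral {0<..<1} (\<lambda>s::real. 0::real)"
    by (rule Henstock_Kurzweil_Integration.integral_cong) (simp add: green_zero)
  then show ?thesis by (simp add: T_def)
qed

lemma T_mono: "\<lbrakk>0 \<le> t; t \<le> t'; t' \<le> \<eta>\<rbrakk> \<Longrightarrow> T lam d u t \<le> T lam d u t'"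
  using T_mono_kernel[of t t' 1] green_mono[OF eta, of _ t t'] eta by simp

lemma T_le_eta: "t \<in> {0..1} \<Longrightarrow> T lam d u t \<le> T lam d u \<eta>"
  using T_mono_kernel[of t \<eta> 1] green_le[OF eta, of _ t] eta by simp

lemma T_ge_eta: "t \<in> {0..1} \<Longrightarrow> c0 * t * T lam d u \<eta> \<le> T lam d u t"
  using T_mono_kernel[of \<eta> t "c0 * t"] green_ge[OF eta, of _ t] eta by (simp add: c0_def)

lemma T_eta_lower:
  assumes K: "\<And>s. s \<in> {\<alpha>..\<beta>} \<Longrightarrow> K \<le> M + f s (reg lam d u s)" and "0 \<le> K"
  shows "lam * (K * \<kappa>) \<le> T lam d u \<eta>"
proof -
  let ?F = "\<lambda>s. green \<eta> \<eta> s * (M + f s (reg lam d u s))"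
  have i: "?F integrable_on {0<..<1}" using eta by (intro green_integrable) auto
  have nn: "0 \<le> ?F s" if "s \<in> {0<..<1}" for s
    using reg_facts(3)[OF that] by (auto simp: green_eta)
  have i': "?F integrable_on {\<alpha>..\<beta>}"
  proof (rule integrable_continuous_interval, rule continuous_on_subset[of "{0<..<1}"])
    show "continuous_on {0<..<1} ?F"
      using reg_facts by (intro continuous_intros f_comp_continuous continuous_on_reg u)
  qed (use alpha_beta in auto)
  have "K * \<kappa> = integral {\<alpha>..\<beta>} (\<lambda>s. ((min \<alpha> \<eta>)\<^sup>2 / 2) * K)"
    using alpha_beta by (simp add: \<kappa>_def)
  also have "\<dots> \<le> integral {\<alpha>..\<beta>} ?F"
  proof (rule integral_le)
    fix s :: real assume s: "s \<in> {\<alpha>..\<beta>}"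
    have "(min \<alpha> \<eta>)\<^sup>2 \<le> (min s \<eta>)\<^sup>2" using s alpha_beta eta by (intro power_mono) auto
    then show "((min \<alpha> \<eta>)\<^sup>2 / 2) * K \<le> ?F s" using K[OF s] assms(2)
      unfolding green_eta by (intro mult_mono) auto
  qed (use i' in auto)
  also have "\<dots> \<le> integral {0<..<1} ?F"
  proof (rule integral_subset_le)
    show "{\<alpha>..\<beta>} \<subseteq> {0<..<1}" using alpha_beta by auto
  qed (use i i' nn in blast)+
  finally show ?thesis using lam by (simp add: T_def)
qed

lemma T_eta_pos: "lam * \<kappa> \<le> T lam d u \<eta>"
  using T_eta_lower[of 1] reg_facts(3) alpha_beta by simp

end

definition sol :: "real \<Rightarrow> real \<Rightarrow> real \<Rightarrow> (real \<Rightarrow> real) \<Rightarrow> bool" where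
  "sol lam d \<mu> u \<longleftrightarrow> continuous_on {0..1} u \<and> (\<forall>t\<in>{0..1}. u t = \<mu> * T lam d u t)"

lemma continuous_bound_obtain:
  fixes u :: "real \<Rightarrow> real"
  assumes "continuous_on {0..1} u" "0 < d"
  obtains B H where "\<And>t. t \<in> {0..1} \<Longrightarrow> u t \<le> B" "\<And>x. x \<in> {d..max B d} \<Longrightarrow> h x \<le> H"
proof -
  have "bounded (u ` {0..1})" using assms by (intro compact_imp_bounded compact_continuous_image) auto
  then obtain B where "\<forall>y\<in>u ` {0..1}. norm y \<le> B" unfolding bounded_iff by blast
  then have "u t \<le> B" if "t \<in> {0..1}" for t using that by (force dest: abs_le_D1)
  moreover obtain H where "\<And>x. x \<in> {d..max B d} \<Longrightarrow> h x \<le> H" using h_bounded[OF assms(2)] by blast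
  ultimately show ?thesis by (rule that)
qed

context
  fixes lam d \<mu> :: real and u :: "real \<Rightarrow> real"
  assumes lam: "0 < lam" and d: "0 < d" and mu: "0 \<le> \<mu>" and sol: "sol lam d \<mu> u"
begin

lemma sol_continuous: "continuous_on {0..1} u"
  using sol by (simp add: sol_def)

lemma sol_eq: "t \<in> {0..1} \<Longrightarrow> u t = \<mu> * T lam d u t"
  using sol by (simp add: sol_def)

lemma sol_shape:
  shows "u 0 = 0"
    and "\<lbrakk>0 \<le> t; t \<le> t'; t' \<le> \<eta>\<rbrakk> \<Longrightarrow> u t \<le> u t'"
    and "t \<in> {0..1} \<Longrightarrow> u t \<le> u \<eta>"
    and "t \<in> {0..1} \<Longrightarrow> c0 * t * u \<eta> \<le> u t"
proof -
  obtain B H where "\<And>t. t \<in> {0..1} \<Longrightarrow> u t \<le> B" "\<And>x. x \<in> {d..max B d} \<Longrightarrow> h x \<le> H"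
    using continuous_bound_obtain[OF sol_continuous d] by blast
  note ctx = lam d sol_continuous this
  have e: "\<eta> \<in> {0..1}" using eta by auto
  show "u 0 = 0" using T_zero[OF ctx] sol_eq[of 0] by simp
  show "u t \<le> u t'" if "0 \<le> t" "t \<le> t'" "t' \<le> \<eta>"
    using T_mono[OF ctx that] mu that eta by (simp add: sol_eq mult_left_mono)
  show "u t \<le> u \<eta>" if "t \<in> {0..1}"
    using T_le_eta[OF ctx that] mu that e by (simp add: sol_eq mult_left_mono)
  show "c0 * t * u \<eta> \<le> u t" if "t \<in> {0..1}"
    using mult_left_mono[OF T_ge_eta[OF ctx that] mu] sol_eq[OF that] sol_eq[OF e]
    by (simp add: mult.left_commute)
qed

lemma sol_diff_bound:
  assumes mu1: "\<mu> \<le> 1" and \<tau>: "0 < \<tau>" "\<tau> \<le> \<eta>" and t: "t \<in> {\<tau>..1}" "t' \<in> {\<tau>..1}"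
    and K: "\<And>s. s \<in> {\<tau>..<1} \<Longrightarrow> h (reg lam d u s) \<le> K" "0 \<le> K"
  shows "\<bar>u t - u t'\<bar> \<le> lam * (K * \<Gamma>) * \<bar>t - t'\<bar>"
proof -
  obtain B H where "\<And>t. t \<in> {0..1} \<Longrightarrow> u t \<le> B" "\<And>x. x \<in> {d..max B d} \<Longrightarrow> h x \<le> H"
    using continuous_bound_obtain[OF sol_continuous d] by blast
  note ctx = lam d sol_continuous this
  have t01: "t \<in> {0..1}" "t' \<in> {0..1}" using t \<tau> by auto
  have "\<bar>integral {0<..<1} (\<lambda>s. (green \<eta> t s - green \<eta> t' s) * (M + f s (reg lam d u s)))\<bar> \<le> \<bar>t - t'\<bar> * K * \<Gamma>"
  proof (rule kernel_integral(2))
    fix s :: real assume s: "s \<in> {0<..<1}"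
    show "0 < reg lam d u s" using reg_facts(1)[OF ctx s] .
    show "green \<eta> t s - green \<eta> t' s = 0 \<or>
          \<bar>green \<eta> t s - green \<eta> t' s\<bar> \<le> \<bar>t - t'\<bar> * min s \<eta> \<and> h (reg lam d u s) \<le> K"
    proof (cases "s \<le> \<tau>")
      case True
      then show ?thesis using \<tau> t by (simp add: green_past)
    next
      case False
      then show ?thesis using s t01 by (auto intro!: green_lipschitz[OF eta] K)
    qed
  qed (use K in \<open>auto intro!: continuous_on_reg sol_continuous continuous_intros\<close>)
  then have "\<bar>T lam d u t - T lam d u t'\<bar> \<le> lam * (K * \<Gamma>) * \<bar>t - t'\<bar>"
    using lam by (subst T_diff[OF ctx t01]) (auto simp: abs_mult mult.assoc mult.left_commute mult.commute)
  moreover have "\<bar>u t - u t'\<bar> \<le> 1 * \<bar>T lam d u t - T lam d u t'\<bar>"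
    unfolding sol_eq[OF t01(1)] sol_eq[OF t01(2)] right_diff_distrib[symmetric] abs_mult
    using mu mu1 by (intro mult_right_mono) auto
  ultimately show ?thesis unfolding mult_1 by (rule order_trans[rotated])
qed

lemma shift_ge_half:
  assumes "2 * lam * M \<le> c0 * u \<eta>" "t \<in> {0..1}"
  shows "u t / 2 \<le> shift lam u t"
proof -
  have "2 * lam * M * t \<le> c0 * u \<eta> * t" using assms by (intro mult_right_mono) auto
  also have "\<dots> \<le> u t" using sol_shape(4)[OF assms(2)] by (simp add: mult_ac)
  finally show ?thesis using shift_ge[of lam t u] lam assms(2) by simp
qed

lemma reg_range:
  assumes "2 * lam * M \<le> c0 * u \<eta>" "t \<in> {0..1}" "d \<le> 1" "u \<eta> \<le> B"
  shows "reg lam d u t \<in> {u t / 2..max B 1}"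
  using shift_ge_half[OF assms(1,2)] shift_le[of lam t u] sol_shape(3)[OF assms(2)] lam assms
  by (auto simp: reg_def)

text \<open>Near \<open>0\<close> no uniform integrable majorant is available. The solution is instead controlled while it
  climbs from \<open>e / 2\<close> to \<open>e\<close>, where its values stay away from the singularity of \<open>h\<close>.\<close>

lemma sol_small_near_zero:
  assumes mu1: "\<mu> \<le> 1" and d1: "d \<le> 1" and big: "2 * lam * M \<le> c0 * u \<eta>" "u \<eta> \<le> B"
    and t: "0 \<le> t" "t \<le> \<eta>" and e: "0 < e" "e \<le> u t"
    and K: "\<And>x. x \<in> {c0 * e / 4..max B 1} \<Longrightarrow> h x \<le> K" "0 \<le> K"
  shows "e \<le> 2 * lam * (K * \<Gamma>) * t"
proof -
  have "continuous_on {0..t} u" using t eta by (intro continuous_on_subset[OF sol_continuous]) auto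
  then obtain \<tau> where \<tau>: "0 \<le> \<tau>" "\<tau> \<le> t" "u \<tau> = e / 2"
    using IVT'[of u 0 "e / 2" t] sol_shape(1) t e by auto
  have \<tau>0: "0 < \<tau>" using \<tau> sol_shape(1) e by (cases "\<tau> = 0") auto
  have low: "c0 * e / 2 \<le> u s" if s: "s \<in> {\<tau>..<1}" for s
  proof (cases "s \<le> \<eta>")
    case True
    have "c0 * e \<le> 1 * e" using c0 e by (intro mult_right_mono) auto
    moreover have "u \<tau> \<le> u s" using sol_shape(2)[of \<tau> s] True s \<tau> by auto
    ultimately show ?thesis using \<tau> by linarith
  next
    case False
    then have s': "1 / 2 \<le> s" "s \<in> {0..1}" using s eta \<tau>0 by auto
    have "e \<le> u \<eta>" using sol_shape(2)[of t \<eta>] t e by auto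
    then have "c0 * (1 / 2) * e \<le> c0 * s * u \<eta>" using c0 s' e by (intro mult_mono) auto
    then show ?thesis using sol_shape(4)[OF s'(2)] by simp
  qed
  have "\<bar>u t - u \<tau>\<bar> \<le> lam * (K * \<Gamma>) * \<bar>t - \<tau>\<bar>"
  proof (rule sol_diff_bound[OF mu1 \<tau>0])
    show "h (reg lam d u s) \<le> K" if "s \<in> {\<tau>..<1}" for s
      using reg_range[OF big(1) _ d1 big(2), of s] low[OF that] that \<tau>0 by (intro K) auto
  qed (use \<tau> t eta K in auto)
  also have "\<dots> \<le> lam * (K * \<Gamma>) * t" using lam K Gamma_nonneg \<tau> t by (intro mult_left_mono) auto
  finally show ?thesis using \<tau> e by simp
qed

end

lemma no_sol_with_norm:
  assumes \<rho>: "0 < \<rho>"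
  shows "\<exists>l>0. \<forall>lam d \<mu> u. 0 < lam \<and> lam < l \<and> 0 < d \<and> d \<le> 1 \<and> 0 \<le> \<mu> \<and> \<mu> \<le> 1 \<and> sol lam d \<mu> u \<longrightarrow> u \<eta> \<noteq> \<rho>"
proof -
  have "0 < c0 * \<rho> / 4" using c0 \<rho> by simp
  then obtain K where K: "0 < K" "\<And>x. x \<in> {c0 * \<rho> / 4..max \<rho> 1} \<Longrightarrow> h x \<le> K" using h_bounded by blast
  define l where "l = min (c0 * \<rho> / (2 * M)) (\<rho> / (2 * (K * \<Gamma>) + 1))"
  have KG: "0 \<le> K * \<Gamma>" using K Gamma_nonneg by simp
  have "0 < l" using c0 \<rho> M_pos KG unfolding l_def by simp
  moreover have False if *: "0 < lam" "lam < l" "0 < d" "d \<le> 1" "0 \<le> \<mu>" "\<mu> \<le> 1" "sol lam d \<mu> u" "u \<eta> = \<rho>" for lam d \<mu> u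
  proof -
    have l: "lam < c0 * \<rho> / (2 * M)" "lam < \<rho> / (2 * (K * \<Gamma>) + 1)" using *(2) by (auto simp: l_def)
    have "2 * lam * M \<le> c0 * u \<eta>" using l(1) M_pos *(8) by (simp add: field_simps)
    then have "\<rho> \<le> 2 * lam * (K * \<Gamma>) * \<eta>"
      using * K \<rho> eta by (intro sol_small_near_zero[of lam d \<mu> u \<rho>]) auto
    also have "\<dots> \<le> 2 * lam * (K * \<Gamma>) * 1" using * KG eta by (intro mult_left_mono) auto
    also have "\<dots> < \<rho>"
    proof -
      have "lam * (2 * (K * \<Gamma>) + 1) < \<rho>" using l(2) KG by (simp add: pos_less_divide_eq)
      then show ?thesis using *(1) by (simp add: algebra_simps)
    qed
    finally show False by simp
  qed
  ultimately show ?thesis by blast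
qed

lemma sol_norm_lower:
  "\<exists>l>0. \<exists>d0>0. \<forall>lam d u. 0 < lam \<and> lam < l \<and> 0 < d \<and> d < d0 \<and> sol lam d 1 u \<longrightarrow> 2 * lam * M \<le> c0 * u \<eta>"
proof -
  define K where "K = 2 * M / (c0 * \<kappa>)"
  have K: "0 < K" using c0 kappa_pos M_pos by (simp add: K_def)
  from lim_0 have "\<forall>\<^sub>F x in at_right 0. \<forall>t\<in>{\<alpha>..\<beta>}. K \<le> f t x" unfolding uniformly_at_top_def by blast
  then obtain b where b: "0 < b" "\<And>x t. \<lbrakk>0 < x; x < b; t \<in> {\<alpha>..\<beta>}\<rbrakk> \<Longrightarrow> K \<le> f t x"
    unfolding eventually_at_right_field by blast
  define l where "l = c0 * b / (2 * M)"
  have l: "0 < l" using c0 b M_pos by (simp add: l_def)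
  have "2 * lam * M \<le> c0 * u \<eta>" if *: "0 < lam" "lam < l" "0 < d" "d < b" "sol lam d 1 u" for lam d u
  proof (rule ccontr)
    assume "\<not> ?thesis"
    then have small: "c0 * u \<eta> < 2 * lam * M" by simp
    have "2 * lam * M < c0 * b" using *(2) M_pos by (simp add: l_def field_simps)
    then have "u \<eta> < b" using small c0 by (smt (verit) mult_less_cancel_left_pos)
    have ub: "u t \<le> u \<eta>" if "t \<in> {0..1}" for t using sol_shape(3)[OF *(1,3) _ *(5) that] by simp
    obtain H where H: "\<And>x. x \<in> {d..max (u \<eta>) d} \<Longrightarrow> h x \<le> H" using h_bounded[OF *(3)] by blast
    note ctx = *(1,3) sol_continuous[OF *(1,3) _ *(5), simplified] ub H
    have "lam * (K * \<kappa>) \<le> T lam d u \<eta>"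
    proof (rule T_eta_lower[OF ctx])
      fix s assume s: "s \<in> {\<alpha>..\<beta>}"
      then have s': "s \<in> {0..1}" using alpha_beta by auto
      have "0 < reg lam d u s" "reg lam d u s < b"
        using reg_bounds[of lam d s u "u \<eta>", OF _ *(3) s' ub[OF s']] *(1,4) \<open>u \<eta> < b\<close> by auto
      from b(2)[OF this s] show "K \<le> M + f s (reg lam d u s)" using M_pos by simp
    qed (use K in auto)
    also have "T lam d u \<eta> = u \<eta>" using sol_eq[OF *(1,3) _ *(5), of \<eta>] eta by simp
    finally have "c0 * (lam * (K * \<kappa>)) \<le> c0 * u \<eta>" using c0 by (intro mult_left_mono) auto
    moreover have "c0 * (lam * (K * \<kappa>)) = 2 * lam * M" using c0 kappa_pos by (simp add: K_def)
    ultimately show False using small by simp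
  qed
  then show ?thesis using l b(1) by blast
qed

lemma no_large_sol:
  assumes lam: "0 < lam"
  shows "\<exists>R>R0. \<forall>d \<mu> u. 0 < d \<and> 1 \<le> \<mu> \<and> sol lam d \<mu> u \<longrightarrow> u \<eta> \<noteq> R"
proof -
  define K where "K = 4 / (lam * c0 * \<alpha> * \<kappa>)"
  have K: "0 < K" using c0 kappa_pos lam alpha_beta by (simp add: K_def)
  from lim_inf have "\<forall>\<^sub>F x in at_top. \<forall>t\<in>{\<alpha>..\<beta>}. K \<le> f t x / x" unfolding uniformly_at_top_def by blast
  then obtain X where X: "\<And>x t. \<lbrakk>X \<le> x; t \<in> {\<alpha>..\<beta>}\<rbrakk> \<Longrightarrow> K \<le> f t x / x"
    unfolding eventually_at_top_linorder by blast
  have ca: "0 < c0 * \<alpha> / 2" using c0 alpha_beta by simp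
  define R where "R = max (max (R0 + 1) 1) (max (2 * lam * M / c0) (X / (c0 * \<alpha> / 2)))"
  have R: "R0 < R" "0 < R" "2 * lam * M / c0 \<le> R" "X / (c0 * \<alpha> / 2) \<le> R" by (auto simp: R_def)
  have RX: "X \<le> c0 * \<alpha> / 2 * R" using pos_divide_le_eq[THEN iffD1, OF ca R(4)] by (simp only: mult.commute)
  have RM: "2 * lam * M \<le> c0 * R" using R(3) c0 by (simp add: pos_divide_le_eq mult.commute)
  have False if *: "0 < d" "1 \<le> \<mu>" "sol lam d \<mu> u" "u \<eta> = R" for d \<mu> u
  proof -
    have mu: "0 \<le> \<mu>" using * by simp
    have ub: "u t \<le> R" if "t \<in> {0..1}" for t using sol_shape(3)[OF lam *(1) mu *(3) that] *(4) by simp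
    obtain H where H: "\<And>x. x \<in> {d..max R d} \<Longrightarrow> h x \<le> H" using h_bounded[OF *(1)] by blast
    note ctx = lam *(1) sol_continuous[OF lam *(1) mu *(3)] ub H
    have "lam * (K * (c0 * \<alpha> / 2 * R) * \<kappa>) \<le> T lam d u \<eta>"
    proof (rule T_eta_lower[OF ctx])
      fix s :: real assume s: "s \<in> {\<alpha>..\<beta>}"
      then have s': "s \<in> {0..1}" using alpha_beta by auto
      have "c0 * \<alpha> * R \<le> c0 * s * R" using s c0 R by (intro mult_right_mono mult_left_mono) auto
      also have "\<dots> \<le> u s" using sol_shape(4)[OF lam *(1) mu *(3) s'] *(4) by simp
      also have "u s / 2 \<le> reg lam d u s"
        using shift_ge_half[OF lam *(1) mu *(3) _ s'] RM *(4) by (simp add: reg_def)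
      finally have x: "c0 * \<alpha> / 2 * R \<le> reg lam d u s" by simp
      have "0 < c0 * \<alpha> / 2 * R" using ca R by (intro mult_pos_pos)
      then have x0: "0 < reg lam d u s" using x by linarith
      have "K * reg lam d u s \<le> f s (reg lam d u s)"
        using X[OF order_trans[OF RX x] s] x0 by (simp add: pos_le_divide_eq)
      moreover have "K * (c0 * \<alpha> / 2 * R) \<le> K * reg lam d u s" using x K by (intro mult_left_mono) auto
      ultimately show "K * (c0 * \<alpha> / 2 * R) \<le> M + f s (reg lam d u s)" using M_pos by linarith
    next
      show "0 \<le> K * (c0 * \<alpha> / 2 * R)" using K ca R by (intro mult_nonneg_nonneg less_imp_le)
    qed
    moreover have "lam * (K * (c0 * \<alpha> / 2 * R) * \<kappa>) = 2 * R"
      using lam c0 alpha_beta kappa_pos by (simp add: K_def field_simps)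
    ultimately have "2 * R \<le> T lam d u \<eta>" by (simp only:)
    also have "\<dots> \<le> \<mu> * T lam d u \<eta>" using \<open>2 * R \<le> _\<close> R * by (simp add: mult_le_cancel_right1)
    also have "\<dots> = R" using sol_eq[OF lam *(1) mu *(3), of \<eta>] *(4) eta by simp
    finally show False using R by simp
  qed
  then show ?thesis using R(1) by blast
qed

lemma dominated_integrable:
  assumes "continuous_on {0<..<1} k" "\<And>s. s \<in> {0<..<1} \<Longrightarrow> \<bar>k s\<bar> \<le> C * (min s \<eta> * g s)"
  shows "k integrable_on {0<..<1}"
proof (rule measurable_bounded_by_integrable_imp_integrable)
  show "k \<in> borel_measurable (lebesgue_on {0<..<1})"
    using assms(1) by (intro continuous_imp_measurable_on_sets_lebesgue) auto
  show "(\<lambda>s. C * (min s \<eta> * g s)) integrable_on {0<..<1}"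
    using integrable_on_mult_right[OF g_int, of C] by simp
qed (use assms in auto)

lemma T_uniform_limit:
  assumes lam: "0 < lam" and d: "0 < d"
    and v: "\<And>n. continuous_on {0..1} (v n)" "\<And>n t. t \<in> {0..1} \<Longrightarrow> v n t \<le> B"
    and u: "continuous_on {0..1} u" "\<And>t. t \<in> {0..1} \<Longrightarrow> u t \<le> B"
    and lim: "uniform_limit {0..1} v u sequentially"
  shows "uniform_limit {0..1} (\<lambda>n. T lam d (v n)) (T lam d u) sequentially"
proof -
  obtain H where H: "\<And>x. x \<in> {d..max B d} \<Longrightarrow> h x \<le> H" using h_bounded[OF d] by blast
  note cv = lam d v H and cu = lam d u H
  define F where "F w s = M + f s (reg lam d w s)" for w s
  define E where "E n s = min s \<eta> * \<bar>F (v n) s - F u s\<bar>" for n s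
  have Fv: "0 \<le> F (v n) s" "F (v n) s \<le> g s * H" if "s \<in> {0<..<1}" for n s
    using reg_facts(3,4)[OF cv that, of n] by (auto simp: F_def)
  have Fu: "0 \<le> F u s" "F u s \<le> g s * H" if "s \<in> {0<..<1}" for s
    using reg_facts(3,4)[OF cu that] by (auto simp: F_def)
  have Ele: "\<bar>E n s\<bar> \<le> H * (min s \<eta> * g s)" if s: "s \<in> {0<..<1}" for n s
  proof -
    have "min s \<eta> * \<bar>F (v n) s - F u s\<bar> \<le> min s \<eta> * (g s * H)"
      using Fv[OF s, of n] Fu[OF s] s eta by (intro mult_left_mono) auto
    then show ?thesis using s eta by (simp add: E_def abs_mult mult_ac)
  qed
  have Eint: "E n integrable_on {0<..<1}" for n
    using reg_facts(1)[OF cv] reg_facts(1)[OF cu] unfolding E_def F_def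
    by (intro dominated_integrable[of _ H] Ele[unfolded E_def F_def] continuous_intros f_comp_continuous
        continuous_on_reg v u)
  have Elim: "(\<lambda>n. E n s) \<longlonglongrightarrow> 0" if s: "s \<in> {0<..<1}" for s
  proof -
    have s': "s \<in> {0..1}" using s by auto
    have "(\<lambda>n. v n s) \<longlonglongrightarrow> u s" using tendsto_uniform_limitI[OF lim s'] .
    then have "(\<lambda>n. reg lam d (v n) s) \<longlonglongrightarrow> reg lam d u s" unfolding reg_def shift_def
      by (intro tendsto_intros)
    moreover have "isCont (f s) (reg lam d u s)" by (rule f_isCont[OF s reg_facts(1)[OF cu s]])
    ultimately have "(\<lambda>n. f s (reg lam d (v n) s)) \<longlonglongrightarrow> f s (reg lam d u s)" by (rule isCont_tendsto_compose[rotated])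
    then have "(\<lambda>n. E n s) \<longlonglongrightarrow> min s \<eta> * \<bar>F u s - F u s\<bar>" unfolding E_def F_def by (intro tendsto_intros)
    then show ?thesis by simp
  qed
  have Hint: "(\<lambda>s. H * (min s \<eta> * g s)) integrable_on {0<..<1}"
    using integrable_on_mult_right[OF g_int, of H] by simp
  have "(\<lambda>n. integral {0<..<1} (E n)) \<longlonglongrightarrow> integral {0<..<1} (\<lambda>s :: real. 0 :: real)"
    by (rule dominated_convergence(2)[OF Eint Hint _ Elim]) (use Ele in simp)
  then have lim0: "(\<lambda>n. integral {0<..<1} (E n)) \<longlonglongrightarrow> 0" by simp
  have le: "\<bar>T lam d (v n) t - T lam d u t\<bar> \<le> lam * integral {0<..<1} (E n)" if t: "t \<in> {0..1}" for n t
  proof -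
    have i: "(\<lambda>s. green \<eta> t s * F (v n) s) integrable_on {0<..<1}" "(\<lambda>s. green \<eta> t s * F u s) integrable_on {0<..<1}"
      using green_integrable[OF cv t, of n] green_integrable[OF cu t] by (simp_all add: F_def)
    have eq: "T lam d (v n) t - T lam d u t = lam * integral {0<..<1} (\<lambda>s. green \<eta> t s * (F (v n) s - F u s))"
      unfolding T_def F_def[symmetric] right_diff_distrib
      by (simp add: Henstock_Kurzweil_Integration.integral_diff[OF i] right_diff_distrib)
    have "\<bar>integral {0<..<1} (\<lambda>s. green \<eta> t s * (F (v n) s - F u s))\<bar> \<le> integral {0<..<1} (E n)"
      unfolding real_norm_def[symmetric]
    proof (rule integral_norm_bound_integral)
      show "(\<lambda>s. green \<eta> t s * (F (v n) s - F u s)) integrable_on {0<..<1}"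
        unfolding right_diff_distrib by (intro integrable_diff i)
      fix s :: real assume s: "s \<in> {0<..<1}"
      have "\<bar>green \<eta> t s - green \<eta> 0 s\<bar> \<le> \<bar>t - 0\<bar> * min s \<eta>" using s t by (intro green_lipschitz[OF eta]) auto
      also have "\<dots> \<le> 1 * min s \<eta>" using s t eta by (intro mult_right_mono) auto
      finally have "\<bar>green \<eta> t s\<bar> \<le> min s \<eta>" using s by (simp add: green_zero)
      then show "norm (green \<eta> t s * (F (v n) s - F u s)) \<le> E n s"
        by (simp add: E_def abs_mult mult_right_mono)
    qed (rule Eint)
    then show ?thesis unfolding eq using lam by (simp add: abs_mult)
  qed
  show ?thesis
  proof (rule uniform_limitI)
    fix e :: real assume e: "0 < e"
    have "(\<lambda>n. lam * integral {0<..<1} (E n)) \<longlonglongrightarrow> lam * 0" by (intro tendsto_intros lim0)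
    then have "\<forall>\<^sub>F n in sequentially. lam * integral {0<..<1} (E n) < e" using e by (intro order_tendstoD) auto
    then show "\<forall>\<^sub>F n in sequentially. \<forall>t\<in>{0..1}. dist (T lam d (v n) t) (T lam d u t) < e"
      by eventually_elim (auto simp: dist_real_def intro: le_less_trans[OF le])
  qed
qed

text \<open>The map below prescribes the value at \<open>\<eta>\<close> of the image, while its direction is that of \<open>T u\<close>. Choosing
  \<open>\<phi> a b\<close> decreasing in \<open>b\<close> turns a cone expansion into a self-map, so that one fixed point principle covers
  both halves of Krasnoselskii's theorem.\<close>

lemma radial_fixed_point:
  assumes lam: "0 < lam" and d: "0 < d" and B: "0 < B"
    and phi: "continuous_on UNIV (\<lambda>(a, b). \<phi> a b)" "\<And>a b. 0 \<le> \<phi> a b" "\<And>a b. \<phi> a b \<le> B"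
  shows "\<exists>u. sol lam d (\<phi> (u \<eta>) (T lam d u \<eta>) / T lam d u \<eta>) u \<and> 0 < T lam d u \<eta>"
proof -
  obtain H where H0: "0 < H" and H: "\<And>x. x \<in> {d..max B d} \<Longrightarrow> h x \<le> H" using h_bounded[OF d] by blast
  define L where "L = B / (lam * \<kappa>) * (lam * (H * \<Gamma>))"
  let ?X = "lip_functions B L"
  define S where "S u t = \<phi> (u \<eta>) (T lam d u \<eta>) / T lam d u \<eta> * T lam d u t" for u t
  have uB: "u t \<le> B" if "u \<in> ?X" "t \<in> {0..1}" for u t using that by (auto simp: lip_functions_def)
  have e: "\<eta> \<in> {0..1}" using eta by auto
  have lk: "0 < lam * \<kappa>" using lam kappa_pos by simp
  have low: "lam * \<kappa> \<le> T lam d u \<eta>" if "u \<in> ?X" for u using T_eta_pos[OF lam d lip_functions_continuous[OF that] uB[OF that] H] .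
  have pos: "0 < T lam d u \<eta>" if "u \<in> ?X" for u using low[OF that] lk by linarith
  have Tn: "0 \<le> T lam d u t" "T lam d u t \<le> T lam d u \<eta>" if u: "u \<in> ?X" and t: "t \<in> {0..1}" for u t
  proof -
    have "0 \<le> c0 * t * T lam d u \<eta>" using c0 t pos[OF u] by simp
    also have "\<dots> \<le> T lam d u t" by (rule T_ge_eta[OF lam d lip_functions_continuous[OF u] uB[OF u] H t])
    finally show "0 \<le> T lam d u t" .
    show "T lam d u t \<le> T lam d u \<eta>" by (rule T_le_eta[OF lam d lip_functions_continuous[OF u] uB[OF u] H t])
  qed
  have L: "0 \<le> L" using B kappa_pos lam Gamma_nonneg H0 by (simp add: L_def)
  have "\<exists>u\<in>?X. \<forall>t\<in>{0..1}. S u t = u t"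
  proof (rule schauder_lip_functions[OF B L])
    fix u assume u: "u \<in> ?X"
    define c where "c = \<phi> (u \<eta>) (T lam d u \<eta>) / T lam d u \<eta>"
    have c: "0 \<le> c" using phi(2) pos[OF u] by (simp add: c_def)
    have cB: "c \<le> B / (lam * \<kappa>)" unfolding c_def using phi(2,3) B lk low[OF u] by (intro frac_le) auto
    have S: "S u t = c * T lam d u t" for t by (simp add: S_def c_def)
    have "S u t \<in> {0..B}" if t: "t \<in> {0..1}" for t
    proof -
      have "c * T lam d u t \<le> c * T lam d u \<eta>" using Tn(2)[OF u t] c by (intro mult_left_mono)
      also have "\<dots> = \<phi> (u \<eta>) (T lam d u \<eta>)" using pos[OF u] by (simp add: c_def)
      finally show ?thesis using Tn(1)[OF u t] c phi(3)[of "u \<eta>" "T lam d u \<eta>"] by (simp add: S)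
    qed
    moreover have "\<bar>S u t - S u t'\<bar> \<le> L * \<bar>t - t'\<bar>" if t: "t \<in> {0..1}" "t' \<in> {0..1}" for t t'
    proof -
      have "\<bar>S u t - S u t'\<bar> = c * \<bar>T lam d u t - T lam d u t'\<bar>"
        using c by (simp add: S abs_mult right_diff_distrib[symmetric])
      also have "\<dots> \<le> B / (lam * \<kappa>) * (lam * (H * \<Gamma>) * \<bar>t - t'\<bar>)"
        using c cB T_lipschitz[OF lam d lip_functions_continuous[OF u] uB[OF u] H t] by (intro mult_mono) auto
      finally show ?thesis by (simp only: L_def mult.assoc)
    qed
    ultimately show "S u \<in> ?X" by (auto simp: lip_functions_def)
  next
    fix v u assume v: "\<And>n. v n \<in> ?X" and u: "u \<in> ?X" and lim: "uniform_limit {0..1} v u sequentially"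
    have Tl: "uniform_limit {0..1} (\<lambda>n. T lam d (v n)) (T lam d u) sequentially"
      by (rule T_uniform_limit[OF lam d lip_functions_continuous[OF v] uB[OF v] lip_functions_continuous[OF u] uB[OF u] lim])
    have pt: "(\<lambda>n. T lam d (v n) \<eta>) \<longlonglongrightarrow> T lam d u \<eta>" by (rule tendsto_uniform_limitI[OF Tl e])
    have "(\<lambda>n. (v n \<eta>, T lam d (v n) \<eta>)) \<longlonglongrightarrow> (u \<eta>, T lam d u \<eta>)"
      by (intro tendsto_Pair pt tendsto_uniform_limitI[OF lim e])
    from continuous_on_tendsto_compose[OF phi(1) this]
    have "(\<lambda>n. \<phi> (v n \<eta>) (T lam d (v n) \<eta>)) \<longlonglongrightarrow> \<phi> (u \<eta>) (T lam d u \<eta>)" by simp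
    then have "(\<lambda>n. \<phi> (v n \<eta>) (T lam d (v n) \<eta>) / T lam d (v n) \<eta>) \<longlonglongrightarrow> \<phi> (u \<eta>) (T lam d u \<eta>) / T lam d u \<eta>"
      using pos[OF u] by (intro tendsto_divide pt) auto
    then have "uniform_limit {0..1} (\<lambda>n (t::real). \<phi> (v n \<eta>) (T lam d (v n) \<eta>) / T lam d (v n) \<eta>)
        (\<lambda>t. \<phi> (u \<eta>) (T lam d u \<eta>) / T lam d u \<eta>) sequentially"
      unfolding uniform_limit_iff tendsto_iff by (auto elim: eventually_mono)
    then show "uniform_limit {0..1} (\<lambda>n. S (v n)) (S u) sequentially"
      unfolding S_def
    proof (rule uniform_lim_mult[OF _ Tl])
      show "bounded (T lam d u ` {0..1})"
        unfolding bounded_iff using Tn[OF u] by (intro exI[of _ "T lam d u \<eta>"]) auto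
    qed (simp add: image_constant_conv)
  qed
  then obtain u where u: "u \<in> ?X" "\<forall>t\<in>{0..1}. S u t = u t" by blast
  then show ?thesis using pos[OF u(1)] lip_functions_continuous[OF u(1)]
    by (intro exI[of _ u]) (auto simp: sol_def S_def)
qed

section \<open>Removing the regularisation\<close>

lemma sol_family_equicontinuous:
  assumes lam: "0 < lam" and lo: "0 < lo" "2 * lam * M \<le> c0 * lo"
    and x: "x \<in> {0..1}" and e: "0 < e"
  shows "\<exists>\<delta>>0. \<forall>d u y. 0 < d \<and> d \<le> 1 \<and> sol lam d 1 u \<and> u \<eta> \<in> {lo..hi} \<and> y \<in> {0..1} \<and> \<bar>x - y\<bar> < \<delta>
           \<longrightarrow> \<bar>u x - u y\<bar> < e"
proof (cases "x = 0")
  case True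
  obtain K where K: "0 < K" "\<And>x. x \<in> {c0 * e / 4..max hi 1} \<Longrightarrow> h x \<le> K"
    using h_bounded[of "c0 * e / 4" "max hi 1"] c0 e by auto
  have lKG: "0 \<le> 2 * lam * (K * \<Gamma>)" using lam K Gamma_nonneg by (intro mult_nonneg_nonneg) auto
  define \<delta> where "\<delta> = min \<eta> (e / (2 * lam * (K * \<Gamma>) + 1))"
  have "0 < e / (2 * lam * (K * \<Gamma>) + 1)" using e lKG by (intro divide_pos_pos add_nonneg_pos) auto
  then have "0 < \<delta>" using eta by (simp add: \<delta>_def)
  moreover have "\<bar>u x - u y\<bar> < e"
    if *: "0 < d" "d \<le> 1" "sol lam d 1 u" "u \<eta> \<in> {lo..hi}" "y \<in> {0..1}" "\<bar>x - y\<bar> < \<delta>" for d u y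
  proof -
    have y: "0 \<le> y" "y \<le> \<eta>" "y < e / (2 * lam * (K * \<Gamma>) + 1)" using *(5,6) True by (auto simp: \<delta>_def)
    have "c0 * lo \<le> c0 * u \<eta>" using *(4) c0 by simp
    then have big: "2 * lam * M \<le> c0 * u \<eta>" using lo by linarith
    have "u y < e"
    proof (rule ccontr)
      assume "\<not> u y < e"
      then have "e \<le> 2 * lam * (K * \<Gamma>) * y"
        using * y e K big by (intro sol_small_near_zero[OF lam *(1) _ *(3), of hi y e K]) auto
      moreover have "y * (2 * lam * (K * \<Gamma>) + 1) < e"
        by (rule pos_less_divide_eq[THEN iffD1, OF add_nonneg_pos[OF lKG zero_less_one] y(3)])
      ultimately show False using y(1) by (simp add: algebra_simps)
    qed
    moreover have "0 \<le> u y" using sol_shape(2)[OF lam *(1) _ *(3), of 0 y] sol_shape(1)[OF lam *(1) _ *(3)] y by simp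
    ultimately show ?thesis using True sol_shape(1)[OF lam *(1) _ *(3)] by simp
  qed
  ultimately show ?thesis by blast
next
  case False
  define \<tau> where "\<tau> = min (x / 2) \<eta>"
  have \<tau>: "0 < \<tau>" "\<tau> \<le> \<eta>" "\<tau> \<le> x / 2" using False x eta by (auto simp: \<tau>_def)
  have "0 < c0 * \<tau> * lo / 2" using c0 \<tau> lo by simp
  then obtain K where K: "0 < K" "\<And>x. x \<in> {c0 * \<tau> * lo / 2..max hi 1} \<Longrightarrow> h x \<le> K"
    using h_bounded by blast
  have lKG: "0 \<le> lam * (K * \<Gamma>)" using lam K Gamma_nonneg by (intro mult_nonneg_nonneg) auto
  define \<delta> where "\<delta> = min (x / 2) (e / (lam * (K * \<Gamma>) + 1))"
  have "0 < e / (lam * (K * \<Gamma>) + 1)" using e lKG by (intro divide_pos_pos add_nonneg_pos) auto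
  then have "0 < \<delta>" using x False by (simp add: \<delta>_def)
  moreover have "\<bar>u x - u y\<bar> < e"
    if *: "0 < d" "d \<le> 1" "sol lam d 1 u" "u \<eta> \<in> {lo..hi}" "y \<in> {0..1}" "\<bar>x - y\<bar> < \<delta>" for d u y
  proof -
    have "c0 * lo \<le> c0 * u \<eta>" using *(4) c0 by simp
    then have big: "2 * lam * M \<le> c0 * u \<eta>" using lo by linarith
    have y: "\<bar>x - y\<bar> < x / 2" "\<bar>x - y\<bar> < e / (lam * (K * \<Gamma>) + 1)" using *(6) by (auto simp: \<delta>_def)
    have "\<bar>u x - u y\<bar> \<le> lam * (K * \<Gamma>) * \<bar>x - y\<bar>"
    proof (rule sol_diff_bound[OF lam *(1) _ *(3) _ \<tau>(1,2)])
      fix s assume s: "s \<in> {\<tau>..<1}"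
      then have s': "s \<in> {0..1}" using \<tau> by auto
      have "c0 * \<tau> * lo \<le> c0 * s * u \<eta>" using s *(4) c0 \<tau> lo by (intro mult_mono) auto
      also have "\<dots> \<le> u s" by (rule sol_shape(4)[OF lam *(1) _ *(3) s']) simp
      finally show "h (reg lam d u s) \<le> K"
        using reg_range[OF lam *(1) _ *(3) big s' *(2), of hi] *(4) by (intro K(2)) auto
    qed (use y \<tau> x * K in \<open>auto simp: abs_if split: if_splits\<close>)
    also have "\<dots> < e"
    proof -
      have "\<bar>x - y\<bar> * (lam * (K * \<Gamma>) + 1) < e"
        by (rule pos_less_divide_eq[THEN iffD1, OF add_nonneg_pos[OF lKG zero_less_one] y(2)])
      then show ?thesis by (simp add: algebra_simps)
    qed
    finally show ?thesis .
  qed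
  ultimately show ?thesis by blast
qed

lemma limit_sol:
  assumes lam: "0 < lam" and lo: "0 < lo" "2 * lam * M \<le> c0 * lo"
    and d: "\<And>n. 0 < d n" "\<And>n::nat. d n \<le> 1" "d \<longlonglongrightarrow> 0"
    and u: "\<And>n. sol lam (d n) 1 (u n)" "\<And>n. u n \<eta> \<in> {lo..hi}"
  obtains v where "continuous_on {0..1} v" "v 0 = 0" "v \<eta> \<in> {lo..hi}"
    "\<And>t. t \<in> {0..1} \<Longrightarrow> v t \<in> {c0 * t * lo..v \<eta>}" "\<And>t. t \<in> {0..1} \<Longrightarrow> v t / 2 \<le> shift lam v t"
    "\<And>\<tau> t. \<lbrakk>0 < \<tau>; \<tau> \<le> \<eta>; t \<in> {\<tau>..1}\<rbrakk> \<Longrightarrow>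
       v t - v \<tau> = lam * integral {0<..<1} (\<lambda>s. (green \<eta> t s - green \<eta> \<tau> s) * (M + f s (shift lam v s)))"
proof -
  have e: "\<eta> \<in> {0..1}" using eta by auto
  have big: "2 * lam * M \<le> c0 * u n \<eta>" for n
  proof -
    have "c0 * lo \<le> c0 * u n \<eta>" using u(2)[of n] c0 by simp
    then show ?thesis using lo by linarith
  qed
  have shape: "t \<in> {0..1} \<Longrightarrow> u n t \<in> {c0 * t * lo..u n \<eta>}" for n t
  proof -
    assume t: "t \<in> {0..1}"
    have "c0 * t * lo \<le> c0 * t * u n \<eta>" using u(2)[of n] c0 t by (intro mult_left_mono) auto
    then show ?thesis using sol_shape(3,4)[OF lam d(1) _ u(1) t, of n] by simp
  qed
  have nn: "0 \<le> c0 * t * lo" if "t \<in> {0..1}" for t using that c0 lo by simp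
  obtain v and k :: "nat \<Rightarrow> nat" where v: "continuous_on {0..1} v" and k: "strict_mono k"
    and unif: "\<And>e. 0 < e \<Longrightarrow> \<exists>N. \<forall>n x. n \<ge> N \<and> x \<in> {0..1} \<longrightarrow> norm (u (k n) x - v x) < e"
  proof (rule Arzela_Ascoli[of "{0..1::real}" u hi])
    show "norm (u n x) \<le> hi" if "x \<in> {0..1}" for n x
      using shape[OF that, of n] nn[OF that] u(2)[of n] by auto
    fix x e :: real assume "x \<in> {0..1}" "0 < e"
    from sol_family_equicontinuous[OF lam lo this, of hi] obtain \<delta> where \<delta>: "\<delta> > 0"
      "\<forall>d u y. 0 < d \<and> d \<le> 1 \<and> sol lam d 1 u \<and> u \<eta> \<in> {lo..hi} \<and> y \<in> {0..1} \<and> \<bar>x - y\<bar> < \<delta> \<longrightarrow> \<bar>u x - u y\<bar> < e"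
      by blast
    have "norm (u n x - u n y) < e" if "y \<in> {0..1} \<and> norm (x - y) < \<delta>" for n y
      using \<delta>(2)[rule_format, of "d n" "u n" y] that d u by simp
    then show "\<exists>\<delta>>0. \<forall>n y. y \<in> {0..1} \<and> norm (x - y) < \<delta> \<longrightarrow> norm (u n x - u n y) < e"
      using \<delta>(1) by blast
  qed auto
  have pt: "(\<lambda>n. u (k n) t) \<longlonglongrightarrow> v t" if t: "t \<in> {0..1}" for t
    using unif t unfolding LIMSEQ_iff by blast
  have ptu: "(\<lambda>n. u (k n) \<eta>) \<longlonglongrightarrow> v \<eta>" by (rule pt[OF e])
  have sh: "(\<lambda>n. shift lam (u (k n)) t) \<longlonglongrightarrow> shift lam v t" if t: "t \<in> {0..1}" for t
    unfolding shift_def by (intro tendsto_intros pt t)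
  have v0: "v 0 = 0"
    using LIMSEQ_unique[OF pt[of 0]] sol_shape(1)[OF lam d(1) _ u(1)] by simp
  have v\<eta>: "v \<eta> \<in> {lo..hi}"
    by (rule closed_sequentially[OF closed_atLeastAtMost _ ptu]) (use u(2) in blast)
  have vt: "v t \<in> {c0 * t * lo..v \<eta>}" if t: "t \<in> {0..1}" for t
    using LIMSEQ_le_const[OF pt[OF t], of "c0 * t * lo"] LIMSEQ_le[OF pt[OF t] ptu] shape[OF t] by auto
  have vhalf: "v t / 2 \<le> shift lam v t" if t: "t \<in> {0..1}" for t
  proof (rule LIMSEQ_le[OF _ sh[OF t]])
    show "(\<lambda>n. u (k n) t / 2) \<longlonglongrightarrow> v t / 2" by (intro tendsto_intros pt t) simp
    show "\<exists>N. \<forall>n\<ge>N. u (k n) t / 2 \<le> shift lam (u (k n)) t"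
      using shift_ge_half[OF lam d(1) _ u(1) big t] by auto
  qed
  have dk: "(\<lambda>n. d (k n)) \<longlonglongrightarrow> 0" using LIMSEQ_subseq_LIMSEQ[OF d(3) k] by (simp add: o_def)
  have "v t - v \<tau> = lam * integral {0<..<1} (\<lambda>s. (green \<eta> t s - green \<eta> \<tau> s) * (M + f s (shift lam v s)))"
    if \<tau>: "0 < \<tau>" "\<tau> \<le> \<eta>" and t: "t \<in> {\<tau>..1}" for \<tau> t
  proof -
    have t01: "t \<in> {0..1}" "\<tau> \<in> {0..1}" using t \<tau> by auto
    have "0 < c0 * \<tau> * lo / 2" using c0 \<tau> lo by simp
    then obtain K where K: "0 < K" "\<And>x. x \<in> {c0 * \<tau> * lo / 2..max hi 1} \<Longrightarrow> h x \<le> K"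
      using h_bounded by blast
    define G where "G s = green \<eta> t s - green \<eta> \<tau> s" for s
    have G: "continuous_on {0<..<1} G" unfolding G_def by (intro continuous_intros)
    have ctx: "0 < reg lam (d n) (u n) s" if "s \<in> {0<..<1}" for n s
      using d(1)[of n] by (simp add: reg_def)
    have bd: "G s = 0 \<or> \<bar>G s\<bar> \<le> \<bar>t - \<tau>\<bar> * min s \<eta> \<and> h (reg lam (d n) (u n) s) \<le> K"
      if s: "s \<in> {0<..<1}" for n s
    proof (cases "s \<le> \<tau>")
      case True
      then show ?thesis using \<tau> t by (simp add: green_past G_def)
    next
      case False
      have s': "s \<in> {0..1}" using s by auto
      have "c0 * \<tau> * lo \<le> c0 * s * lo" using False lo c0 by (intro mult_right_mono mult_left_mono) auto
      then have "h (reg lam (d n) (u n) s) \<le> K"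
        using reg_range[OF lam d(1) _ u(1) big s' d(2), of n hi] shape[OF s', of n] u(2)[of n]
        by (intro K(2)) auto
      then show ?thesis using s t01 by (auto simp: G_def intro!: green_lipschitz[OF eta])
    qed
    have K0: "0 \<le> K" using K by simp
    note ker = kernel_integral[OF continuous_on_reg[OF sol_continuous[OF lam d(1) _ u(1)]] ctx G abs_ge_zero K0 bd, simplified]
    have eq: "lam * integral {0<..<1} (\<lambda>s. G s * (M + f s (reg lam (d n) (u n) s))) = u n t - u n \<tau>" for n
    proof -
      have c: "continuous_on {0..1} (u n)" by (rule sol_continuous[OF lam d(1) _ u(1)]) simp
      obtain B H where "\<And>t. t \<in> {0..1} \<Longrightarrow> u n t \<le> B" "\<And>x. x \<in> {d n..max B (d n)} \<Longrightarrow> h x \<le> H"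
        using continuous_bound_obtain[OF c d(1)] by blast
      from T_diff[OF lam d(1) c this t01] show ?thesis
        using sol_eq[OF lam d(1) _ u(1)] t01 by (simp add: G_def)
    qed
    have "(\<lambda>n. integral {0<..<1} (\<lambda>s. G s * (M + f s (reg lam (d (k n)) (u (k n)) s)))) \<longlonglongrightarrow>
          integral {0<..<1} (\<lambda>s. G s * (M + f s (shift lam v s)))"
    proof (rule dominated_convergence(2))
      show "(\<lambda>s. \<bar>t - \<tau>\<bar> * K * (min s \<eta> * g s)) integrable_on {0<..<1}"
        by (intro integrable_on_mult_right g_int)
      fix s :: real assume s: "s \<in> {0<..<1}"
      have s': "s \<in> {0..1}" using s by auto
      have "0 < c0 * s * lo" using s c0 lo by simp
      then have pos: "0 < shift lam v s" using vhalf[OF s'] vt[OF s'] by simp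
      have "(\<lambda>n. reg lam (d (k n)) (u (k n)) s) \<longlonglongrightarrow> max (shift lam v s) 0"
        unfolding reg_def by (intro tendsto_max sh dk s')
      then have "(\<lambda>n. reg lam (d (k n)) (u (k n)) s) \<longlonglongrightarrow> shift lam v s" using pos by simp
      then have "(\<lambda>n. f s (reg lam (d (k n)) (u (k n)) s)) \<longlonglongrightarrow> f s (shift lam v s)"
        by (rule isCont_tendsto_compose[OF f_isCont[OF s pos]])
      then show "(\<lambda>n. G s * (M + f s (reg lam (d (k n)) (u (k n)) s))) \<longlonglongrightarrow> G s * (M + f s (shift lam v s))"
        by (intro tendsto_intros)
    qed (use ker in \<open>auto simp: real_norm_def\<close>)
    then have "(\<lambda>n. lam * integral {0<..<1} (\<lambda>s. G s * (M + f s (reg lam (d (k n)) (u (k n)) s)))) \<longlonglongrightarrow>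
          lam * integral {0<..<1} (\<lambda>s. G s * (M + f s (shift lam v s)))" by (intro tendsto_intros)
    then have "(\<lambda>n. u (k n) t - u (k n) \<tau>) \<longlonglongrightarrow> lam * integral {0<..<1} (\<lambda>s. G s * (M + f s (shift lam v s)))"
      unfolding eq .
    from LIMSEQ_unique[OF tendsto_diff[OF pt[OF t01(1)] pt[OF t01(2)]] this] show ?thesis by (simp add: G_def)
  qed
  then show ?thesis using that[OF v v0 v\<eta> vt vhalf] by blast
qed

lemma integrable_away_from_zero:
  assumes \<tau>: "0 < \<tau>" "\<tau> < 1" and k: "continuous_on {\<tau>..1} k"
    and x: "continuous_on {0<..<1} x" "\<And>s. s \<in> {0<..<1} \<Longrightarrow> 0 < x s"
    and K: "\<And>s. s \<in> {\<tau><..<1} \<Longrightarrow> h (x s) \<le> K"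
  shows "(\<lambda>s. k s * (M + f s (x s))) integrable_on {\<tau>..1}"
proof -
  have "bounded (k ` {\<tau>..1})" using k by (intro compact_imp_bounded compact_continuous_image) auto
  then obtain C where "\<forall>y\<in>k ` {\<tau>..1}. norm y \<le> C" unfolding bounded_iff by blast
  then have C: "\<bar>k s\<bar> \<le> C" if "s \<in> {\<tau>..1}" for s using that by auto
  have sub: "{\<tau><..<1} \<subseteq> {0<..<1}" using \<tau> by auto
  have m: "0 < min \<tau> \<eta>" using \<tau> eta by simp
  have "(\<lambda>s. min s \<eta> * g s) absolutely_integrable_on {0<..<1}"
    using g_int eta g_pos by (intro nonnegative_absolutely_integrable_1)
      (auto intro!: mult_nonneg_nonneg intro: less_imp_le)
  then have "(\<lambda>s. min s \<eta> * g s) absolutely_integrable_on {\<tau><..<1}"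
    by (rule set_integrable_subset) (use sub in auto)
  then have gi: "(\<lambda>s. C * K / min \<tau> \<eta> * (min s \<eta> * g s)) integrable_on {\<tau><..<1}"
    by (intro integrable_on_mult_right set_lebesgue_integral_eq_integral(1))
  have "(\<lambda>s. k s * (M + f s (x s))) integrable_on {\<tau><..<1}"
  proof (rule measurable_bounded_by_integrable_imp_integrable[OF _ gi])
    have "continuous_on {\<tau><..<1} (\<lambda>s. k s * (M + f s (x s)))"
      by (intro continuous_intros continuous_on_subset[OF k] continuous_on_subset[OF f_comp_continuous[OF x] sub]) auto
    then show "(\<lambda>s. k s * (M + f s (x s))) \<in> borel_measurable (lebesgue_on {\<tau><..<1})"
      by (intro continuous_imp_measurable_on_sets_lebesgue) auto
    fix s assume s: "s \<in> {\<tau><..<1}"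
    then have s': "s \<in> {0<..<1}" using sub by auto
    have F: "1 \<le> M + f s (x s)" "M + f s (x s) \<le> g s * h (x s)" using f_bounds[OF s' x(2)[OF s']] by auto
    have g: "0 < g s" using g_pos[OF s'] .
    have FK: "M + f s (x s) \<le> K * g s" using F(2) mult_left_mono[OF K[OF s] less_imp_le[OF g]] by (simp add: mult.commute)
    then have K0: "0 < K * g s" using F by linarith
    have C0: "0 \<le> C" using C[of s] s by auto
    have "norm (k s * (M + f s (x s))) \<le> C * (K * g s)"
      unfolding real_norm_def abs_mult using C[of s] F FK C0 s by (intro mult_mono) auto
    also have "\<dots> = C * (K * g s) * 1" by simp
    also have "\<dots> \<le> C * (K * g s) * (min s \<eta> / min \<tau> \<eta>)"
    proof (rule mult_left_mono)
      have "min \<tau> \<eta> \<le> min s \<eta>" using s by auto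
      then show "1 \<le> min s \<eta> / min \<tau> \<eta>" by (subst le_divide_eq_1_pos[OF m])
    qed (use C0 K0 in simp)
    finally show "norm (k s * (M + f s (x s))) \<le> C * K / min \<tau> \<eta> * (min s \<eta> * g s)"
      by (simp add: mult_ac)
  qed auto
  then show ?thesis by (simp add: integrable_on_open_interval_real)
qed

lemma limit_sol_solves:
  assumes lam: "0 < lam" and lo: "0 < lo"
    and v: "continuous_on {0..1} v" "v 0 = 0" "\<And>t. t \<in> {0..1} \<Longrightarrow> v t \<in> {c0 * t * lo..v \<eta>}"
    and half: "\<And>t. t \<in> {0..1} \<Longrightarrow> v t / 2 \<le> shift lam v t"
    and eq: "\<And>\<tau> t. \<lbrakk>0 < \<tau>; \<tau> \<le> \<eta>; t \<in> {\<tau>..1}\<rbrakk> \<Longrightarrow>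
       v t - v \<tau> = lam * integral {0<..<1} (\<lambda>s. (green \<eta> t s - green \<eta> \<tau> s) * (M + f s (shift lam v s)))"
  shows "positive_solution \<eta> lam f (shift lam v) \<and> Ck_on 3 {0<..<1} (shift lam v)"
proof -
  let ?x = "shift lam v"
  define F where "F s = M + f s (?x s)" for s
  define V where "V = (\<lambda>t. integral {t..1} F)"
  define y where "y = (\<lambda>t. integral {t..1} V - integral {\<eta>..1} V)"
  have pos: "0 < ?x t" if "t \<in> {0<..1}" for t
  proof -
    have "0 < c0 * t * lo" using that c0 lo by simp
    then show ?thesis using half[of t] v(3)[of t] that by simp
  qed
  have xc: "continuous_on {0..1} ?x" by (intro continuous_on_shift v)
  have xc': "continuous_on {0<..<1} ?x" by (rule continuous_on_subset[OF xc]) auto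
  have Fc: "continuous_on {0<..<1} F" unfolding F_def
    using pos by (intro continuous_intros f_comp_continuous xc') auto
  have int: "(\<lambda>s. k s * F s) integrable_on {\<tau>..1}" if \<tau>: "0 < \<tau>" "\<tau> < 1" and k: "continuous_on {\<tau>..1} k" for \<tau> k
  proof -
    have "0 < c0 * \<tau> * lo / 2" using c0 \<tau> lo by simp
    then obtain K where K: "\<And>x. x \<in> {c0 * \<tau> * lo / 2..v \<eta>} \<Longrightarrow> h x \<le> K" using h_bounded by blast
    have "h (?x s) \<le> K" if s: "s \<in> {\<tau><..<1}" for s
    proof (rule K)
      have s': "s \<in> {0..1}" using s \<tau> by auto
      have "c0 * \<tau> * lo \<le> c0 * s * lo" using s lo c0 by (intro mult_right_mono mult_left_mono) auto
      then show "?x s \<in> {c0 * \<tau> * lo / 2..v \<eta>}"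
        using half[OF s'] v(3)[OF s'] shift_le[of lam s v] lam s' by auto
    qed
    then show ?thesis unfolding F_def using pos by (intro integrable_away_from_zero[OF \<tau> k xc']) auto
  qed
  have F1: "F integrable_on {\<tau>..1}" if "0 < \<tau>" "\<tau> < 1" for \<tau> using int[OF that, of "\<lambda>_. 1"] by simp
  have V_cont: "continuous_on {\<tau>..1} V" if "0 < \<tau>" "\<tau> < 1" for \<tau>
    unfolding V_def by (intro indefinite_integral_continuous_1' F1 that)
  have y_within: "(y has_real_derivative - V t) (at t within {\<tau>..1})" if "0 < \<tau>" "\<tau> < 1" "t \<in> {\<tau>..1}" for t \<tau>
    unfolding y_def by (rule derivative_eq_intros integral_has_real_derivative'[OF V_cont[OF that(1,2)] that(3)] | simp)+
  have y_cont: "continuous_on {\<tau>..1} y" if "0 < \<tau>" "\<tau> < 1" for \<tau>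
    by (rule DERIV_continuous_on[OF y_within[OF that]])
  have v_eq: "v t = v \<tau> + lam * integral {\<tau>..t} y" if \<tau>: "0 < \<tau>" "\<tau> \<le> \<eta>" and t: "t \<in> {\<tau>..1}" for \<tau> t
  proof -
    have "\<tau> < 1" using \<tau> eta by simp
    from green_integral_eq[OF eta(2) \<tau> Fc int[OF \<tau>(1) this] t]
    have "integral {0<..<1} (\<lambda>s. (green \<eta> t s - green \<eta> \<tau> s) * F s) = integral {\<tau>..t} y"
      by (simp only: V_def y_def)
    moreover have "v t - v \<tau> = lam * integral {0<..<1} (\<lambda>s. (green \<eta> t s - green \<eta> \<tau> s) * F s)"
      using eq[OF \<tau> t] by (simp only: F_def)
    ultimately show ?thesis by simp
  qed
  have v_within: "(v has_real_derivative lam * y t) (at t within {\<tau>..1})"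
    if \<tau>: "0 < \<tau>" "\<tau> \<le> \<eta>" and t: "t \<in> {\<tau>..1}" for \<tau> t
  proof -
    have "\<tau> < 1" using \<tau> eta by simp
    have "((\<lambda>t. v \<tau> + lam * integral {\<tau>..t} y) has_real_derivative lam * y t) (at t within {\<tau>..1})"
      by (rule derivative_eq_intros integral_has_real_derivative[OF y_cont[OF \<tau>(1) \<open>\<tau> < 1\<close>] t] | simp)+
    then show ?thesis
      by (rule has_field_derivative_transform_within[OF _ zero_less_one t]) (rule v_eq[OF \<tau>, symmetric])
  qed
  have at_eq: "at t within {0<..1} = at t within {min (t / 2) \<eta>..1}" if "t \<in> {0<..1}" for t :: real
    using that eta by (intro at_within_nhd[of t "{min (t / 2) \<eta><..}"]) auto
  have V_deriv: "DERIV V t :> - F t" if t: "t \<in> {0<..<1}" for t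
  proof (rule has_field_derivative_transform_within_open[of "\<lambda>x. V (t / 2) - integral {t / 2..x} F" _ _ "{t / 2<..<1}"])
    have "isCont F t" using t by (intro continuous_on_interior[OF Fc]) auto
    then have "DERIV (\<lambda>x. integral {t / 2..x} F) t :> F t"
      using t by (intro indefinite_integral_has_real_derivative_interior[of _ _ 1] F1) auto
    then show "DERIV (\<lambda>x. V (t / 2) - integral {t / 2..x} F) t :> - F t"
      by (rule DERIV_diff[OF DERIV_const, simplified])
    show "V (t / 2) - integral {t / 2..x} F = V x" if "x \<in> {t / 2<..<1}" for x
      using Henstock_Kurzweil_Integration.integral_combine[OF _ _ F1, of "t / 2" x] that t by (simp add: V_def)
  qed (use t in auto)
  define x1 where "x1 t = lam * y t - lam * M * (\<eta> - \<eta>\<^sup>2 / 2 - t + t\<^sup>2 / 2)" for t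
  define x2 where "x2 t = - (lam * V t) - lam * M * (t - 1)" for t
  define x3 where "x3 t = lam * f t (?x t)" for t
  have d1: "(?x has_real_derivative x1 t) (at t within {0<..1})" if t: "t \<in> {0<..1}" for t
  proof -
    define \<tau> where "\<tau> = min (t / 2) \<eta>"
    have \<tau>: "0 < \<tau>" "\<tau> \<le> \<eta>" "t \<in> {\<tau>..1}" using t eta by (auto simp: \<tau>_def)
    have "(green_one \<eta> has_real_derivative (\<eta> - \<eta>\<^sup>2 / 2 - t + t\<^sup>2 / 2)) (at t within {\<tau>..1})"
      unfolding green_one_def by (rule derivative_eq_intros refl | simp)+
    from DERIV_diff[OF v_within[OF \<tau>] DERIV_cmult[OF this, of "lam * M"]]
    show ?thesis unfolding at_eq[OF t] shift_def[abs_def] x1_def \<tau>_def .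
  qed
  have d2: "(x1 has_real_derivative x2 t) (at t within {0<..1})" if t: "t \<in> {0<..1}" for t
  proof -
    define \<tau> where "\<tau> = min (t / 2) \<eta>"
    have \<tau>: "0 < \<tau>" "\<tau> < 1" "t \<in> {\<tau>..1}" using t eta by (auto simp: \<tau>_def)
    have "((\<lambda>t. \<eta> - \<eta>\<^sup>2 / 2 - t + t\<^sup>2 / 2) has_real_derivative t - 1) (at t within {\<tau>..1})"
      by (rule derivative_eq_intros refl | simp)+
    from DERIV_diff[OF DERIV_cmult[OF y_within[OF \<tau>], of lam] DERIV_cmult[OF this, of "lam * M"]]
    show ?thesis unfolding at_eq[OF t] x1_def[abs_def] x2_def \<tau>_def by simp
  qed
  have d3: "(x2 has_real_derivative x3 t) (at t)" if t: "t \<in> {0<..<1}" for t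
  proof -
    have "(x2 has_real_derivative - (lam * - F t) - lam * M * (1 - 0)) (at t)" unfolding x2_def[abs_def]
      by (intro DERIV_diff DERIV_minus DERIV_cmult V_deriv t DERIV_ident DERIV_const)
    then show ?thesis by (simp add: x3_def F_def algebra_simps)
  qed
  have "solves_bvp \<eta> lam f ?x" unfolding solves_bvp_def
  proof (rule exI[of _ x1], rule exI[of _ x2], rule exI[of _ x3], intro conjI ballI)
    show "x1 \<eta> = 0" by (simp add: x1_def y_def power2_eq_square field_simps)
    show "?x 0 = 0" using v(2) by (simp add: shift_def green_one_def)
    show "x2 1 = 0" by (simp add: x2_def V_def)
    show "x3 t - lam * f t (?x t) = 0" for t by (simp add: x3_def)
  qed (fact d1 d2 d3)+
  then have "positive_solution \<eta> lam f ?x" using xc pos by (simp add: positive_solution_def)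
  moreover have "Ck_on 3 {0<..<1} ?x"
  proof -
    have s: "{0<..<1::real} \<subseteq> {0<..1}" by auto
    have "continuous_on {0<..<1} x3" unfolding x3_def using pos
      by (intro continuous_intros f_comp_continuous xc') auto
    moreover have "\<forall>t\<in>{0<..<1}. (?x has_real_derivative x1 t) (at t within {0<..<1})"
      using d1 s by (blast intro: DERIV_subset)
    moreover have "\<forall>t\<in>{0<..<1}. (x1 has_real_derivative x2 t) (at t within {0<..<1})"
      using d2 s by (blast intro: DERIV_subset)
    moreover have "\<forall>t\<in>{0<..<1}. (x2 has_real_derivative x3 t) (at t within {0<..<1})"
      using d3 by (auto intro: has_field_derivative_at_within)
    ultimately show ?thesis unfolding numeral_3_eq_3 Ck_on.simps by blast
  qed
  ultimately show ?thesis ..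
qed

lemma limit_positive_solution:
  assumes lam: "0 < lam" and lo: "0 < lo" "2 * lam * M \<le> c0 * lo" and b: "0 < b"
    and u: "\<And>d. \<lbrakk>0 < d; d < b\<rbrakk> \<Longrightarrow> \<exists>u. sol lam d 1 u \<and> u \<eta> \<in> {lo..hi}"
  shows "\<exists>x. positive_solution \<eta> lam f x \<and> Ck_on 3 {0<..<1} x \<and> 0 < norm01 x \<and> norm01 x \<in> {lo - lam * M..hi}"
proof -
  define b' where "b' = min b 1"
  define d where "d n = b' * inverse (real (Suc (Suc n)))" for n
  have b': "0 < b'" "b' \<le> b" "b' \<le> 1" using b by (auto simp: b'_def)
  have i: "0 < inverse (real (Suc (Suc n)))" "inverse (real (Suc (Suc n))) < 1" for n
    by (auto simp: inverse_less_1_iff)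
  have dn: "0 < d n" "d n < b'" for n using b' i[of n] by (auto simp: d_def)
  have "(\<lambda>n. b' * inverse (real (Suc (Suc n)))) \<longlonglongrightarrow> b' * 0"
    by (intro tendsto_mult_left LIMSEQ_Suc[OF LIMSEQ_inverse_real_of_nat])
  then have d0: "d \<longlonglongrightarrow> 0" by (simp add: d_def[abs_def])
  have "\<forall>n. \<exists>u. sol lam (d n) 1 u \<and> u \<eta> \<in> {lo..hi}"
    using u dn b' by (meson less_le_trans)
  then obtain w where w: "\<forall>n. sol lam (d n) 1 (w n) \<and> w n \<eta> \<in> {lo..hi}" by (rule choice[THEN exE])
  have d1: "d n \<le> 1" for n using dn[of n] b' by simp
  obtain v where v: "continuous_on {0..1} v" "v 0 = 0" "v \<eta> \<in> {lo..hi}"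
    "\<And>t. t \<in> {0..1} \<Longrightarrow> v t \<in> {c0 * t * lo..v \<eta>}" "\<And>t. t \<in> {0..1} \<Longrightarrow> v t / 2 \<le> shift lam v t"
    "\<And>\<tau> t. \<lbrakk>0 < \<tau>; \<tau> \<le> \<eta>; t \<in> {\<tau>..1}\<rbrakk> \<Longrightarrow>
       v t - v \<tau> = lam * integral {0<..<1} (\<lambda>s. (green \<eta> t s - green \<eta> \<tau> s) * (M + f s (shift lam v s)))"
    by (rule limit_sol[OF lam lo dn(1) d1 d0, of w hi]) (use w in blast)+
  let ?x = "shift lam v"
  have e: "\<eta> \<in> {0..1}" using eta by auto
  have le: "\<bar>?x t\<bar> \<le> hi" if t: "t \<in> {0..1}" for t
  proof -
    have "0 \<le> c0 * t * lo" using t c0 lo by simp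
    then show ?thesis using v(3) v(4)[OF t] v(5)[OF t] shift_le[of lam t v] lam t by auto
  qed
  have bdd: "bdd_above ((\<lambda>t. \<bar>?x t\<bar>) ` {0..1})" using le by (intro bdd_aboveI[of _ hi]) auto
  have ge: "\<bar>?x \<eta>\<bar> \<le> norm01 ?x" unfolding norm01_def by (intro cSUP_upper e bdd)
  have "norm01 ?x \<le> hi" unfolding norm01_def by (intro cSUP_least le) auto
  moreover have "0 < norm01 ?x" using ge v(3) v(5)[OF e] lo by auto
  moreover have "lo - lam * M \<le> norm01 ?x"
  proof -
    have "lam * M * \<eta> \<le> lam * M * 1" using lam M_pos eta by (intro mult_left_mono) auto
    moreover have "v \<eta> - lam * M * \<eta> \<le> ?x \<eta>" using lam e by (intro shift_ge) auto
    moreover have "lo \<le> v \<eta>" using v(3) by simp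
    ultimately show ?thesis using ge by linarith
  qed
  ultimately show ?thesis using limit_sol_solves[OF lam lo(1) v(1,2,4,5,6)] by auto
qed

theorem two_positive_solutions:
  assumes r: "0 < r"
  shows "\<exists>lam0>0. \<forall>lam\<in>{0<..<lam0}. \<exists>x y. positive_solution \<eta> lam f x \<and> Ck_on 3 {0<..<1} x \<and>
                 positive_solution \<eta> lam f y \<and> Ck_on 3 {0<..<1} y \<and>
                 0 < norm01 x \<and> norm01 x < r \<and> r < norm01 y"
proof -
  obtain l1 where l1: "0 < l1" and no1: "\<And>lam d \<mu> u. \<lbrakk>0 < lam; lam < l1; 0 < d; d \<le> 1; 0 \<le> \<mu>; \<mu> \<le> 1; sol lam d \<mu> u\<rbrakk> \<Longrightarrow> u \<eta> \<noteq> r / 2"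
    using no_sol_with_norm[of "r / 2"] r by auto
  obtain l2 where l2: "0 < l2" and no2: "\<And>lam d \<mu> u. \<lbrakk>0 < lam; lam < l2; 0 < d; d \<le> 1; 0 \<le> \<mu>; \<mu> \<le> 1; sol lam d \<mu> u\<rbrakk> \<Longrightarrow> u \<eta> \<noteq> 2 * r"
    using no_sol_with_norm[of "2 * r"] r by auto
  obtain l3 b where l3: "0 < l3" and b: "0 < b"
    and low: "\<And>lam d u. \<lbrakk>0 < lam; lam < l3; 0 < d; d < b; sol lam d 1 u\<rbrakk> \<Longrightarrow> 2 * lam * M \<le> c0 * u \<eta>"
    using sol_norm_lower by blast
  define l4 where "l4 = c0 * r / (2 * M)"
  have l4: "0 < l4" using c0 r M_pos by (simp add: l4_def)
  define lam0 where "lam0 = min (min l1 l2) (min l3 l4)"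
  have e: "\<eta> \<in> {0..1}" using eta by auto
  have "\<exists>x y. positive_solution \<eta> lam f x \<and> Ck_on 3 {0<..<1} x \<and>
                 positive_solution \<eta> lam f y \<and> Ck_on 3 {0<..<1} y \<and>
                 0 < norm01 x \<and> norm01 x < r \<and> r < norm01 y" if "lam \<in> {0<..<lam0}" for lam
  proof -
    have lam: "0 < lam" "lam < l1" "lam < l2" "lam < l3" "lam < l4" using that by (auto simp: lam0_def)
    have lM: "2 * lam * M < c0 * r" using lam(5) M_pos by (simp add: l4_def pos_less_divide_eq mult_ac)
    define b1 where "b1 = min b 1"
    have b1: "0 < b1" using b by (simp add: b1_def)
    have small: "\<exists>u. sol lam d 1 u \<and> u \<eta> \<in> {2 * lam * M / c0..r / 2}" if d: "0 < d" "d < b1" for d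
    proof -
      have "continuous_on UNIV (\<lambda>(a, b). max 0 (min b (r / 2)) :: real)"
        unfolding case_prod_beta by (intro continuous_intros)
      then have "\<exists>u. sol lam d (max 0 (min (T lam d u \<eta>) (r / 2)) / T lam d u \<eta>) u \<and> 0 < T lam d u \<eta>"
        by (rule radial_fixed_point[OF lam(1) d(1), of "r / 2", rotated]) (use r in auto)
      then obtain u where u: "sol lam d (max 0 (min (T lam d u \<eta>) (r / 2)) / T lam d u \<eta>) u"
        and Tp: "0 < T lam d u \<eta>" by blast
      define \<mu> where "\<mu> = min (T lam d u \<eta>) (r / 2) / T lam d u \<eta>"
      have u': "sol lam d \<mu> u" using u Tp r by (simp add: \<mu>_def max_def)
      have mu: "0 \<le> \<mu>" "\<mu> \<le> 1" using Tp r by (auto simp: \<mu>_def)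
      have u\<eta>: "u \<eta> = min (T lam d u \<eta>) (r / 2)"
        using sol_eq[OF lam(1) d(1) mu(1) u' e] Tp by (simp add: \<mu>_def)
      then have "u \<eta> < r / 2" using no1[OF lam(1,2) d(1) _ mu u'] d by (auto simp: b1_def)
      then have "\<mu> = 1" using u\<eta> Tp by (auto simp: \<mu>_def min_def split: if_splits)
      then have "sol lam d 1 u" using u' by simp
      moreover from low[OF lam(1,4) d(1) _ this] have "2 * lam * M / c0 \<le> u \<eta>"
        using c0 d by (simp add: b1_def pos_divide_le_eq mult_ac)
      ultimately show ?thesis using \<open>u \<eta> < r / 2\<close> by auto
    qed
    have lo: "0 < 2 * lam * M / c0" "2 * lam * M \<le> c0 * (2 * lam * M / c0)" using lam M_pos c0 by auto
    from limit_positive_solution[OF lam(1) lo b1 small]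
    obtain x where x: "positive_solution \<eta> lam f x" "Ck_on 3 {0<..<1} x" "0 < norm01 x" "norm01 x \<le> r / 2" by auto
    obtain R where R: "2 * r < R" and noR: "\<And>d \<mu> u. \<lbrakk>0 < d; 1 \<le> \<mu>; sol lam d \<mu> u\<rbrakk> \<Longrightarrow> u \<eta> \<noteq> R"
      using no_large_sol[OF lam(1), of "2 * r"] by blast
    have large: "\<exists>u. sol lam d 1 u \<and> u \<eta> \<in> {2 * r..R}" if d: "0 < d" "d < b1" for d
    proof -
      let ?\<phi> = "\<lambda>a b. max (2 * r) (min R (2 * a - b))"
      have "continuous_on UNIV (\<lambda>(a, b). ?\<phi> a b :: real)"
        unfolding case_prod_beta by (intro continuous_intros)
      then have "\<exists>u. sol lam d (?\<phi> (u \<eta>) (T lam d u \<eta>) / T lam d u \<eta>) u \<and> 0 < T lam d u \<eta>"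
        by (rule radial_fixed_point[OF lam(1) d(1), of R, rotated]) (use r R in auto)
      then obtain u where u: "sol lam d (?\<phi> (u \<eta>) (T lam d u \<eta>) / T lam d u \<eta>) u"
        and Tp: "0 < T lam d u \<eta>" by blast
      define \<mu> where "\<mu> = ?\<phi> (u \<eta>) (T lam d u \<eta>) / T lam d u \<eta>"
      have u': "sol lam d \<mu> u" using u by (simp only: \<mu>_def)
      have mu: "0 \<le> \<mu>" using Tp r by (auto simp: \<mu>_def)
      have u\<eta>: "u \<eta> = ?\<phi> (u \<eta>) (T lam d u \<eta>)"
        using sol_eq[OF lam(1) d(1) mu u' e] Tp by (simp add: \<mu>_def)
      have \<mu>u: "\<mu> = u \<eta> / T lam d u \<eta>" using u\<eta> by (simp only: \<mu>_def)
      have "T lam d u \<eta> = u \<eta>"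
      proof (cases "T lam d u \<eta>" "u \<eta>" rule: linorder_cases)
        case less
        then have "1 \<le> \<mu>" using Tp by (simp add: \<mu>u)
        moreover have "u \<eta> = R" using u\<eta> less R r by (auto simp: max_def min_def split: if_splits)
        ultimately show ?thesis using noR[OF d(1) _ u'] by blast
      next
        case greater
        then have "\<mu> \<le> 1" using Tp by (simp add: \<mu>u)
        moreover have "u \<eta> = 2 * r" using u\<eta> greater R r by (auto simp: max_def min_def split: if_splits)
        ultimately show ?thesis using no2[OF lam(1,3) d(1) _ mu _ u'] d by (simp add: b1_def)
      qed simp
      then have "sol lam d 1 u" using u' Tp by (simp add: \<mu>u)
      moreover have "u \<eta> \<in> {2 * r..R}" using u\<eta> R r by (auto simp: max_def min_def split: if_splits)
      ultimately show ?thesis by blast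
    qed
    have "c0 * r \<le> 1 * r" using c0 r by (intro mult_right_mono) auto
    moreover have "0 < lam * M" using lam M_pos by simp
    ultimately have lMr: "lam * M < r" using lM by linarith
    have "0 < c0 * r" using c0 r by simp
    moreover have "c0 * (2 * r) = 2 * (c0 * r)" by simp
    ultimately have "2 * lam * M \<le> c0 * (2 * r)" using lM by linarith
    from limit_positive_solution[OF lam(1) _ this b1 large] r
    obtain y where y: "positive_solution \<eta> lam f y" "Ck_on 3 {0<..<1} y" "2 * r - lam * M \<le> norm01 y" by auto
    have "norm01 x < r" "r < norm01 y" using x(4) y(3) lMr r by auto
    then show ?thesis using x y by blast
  qed
  moreover have "0 < lam0" using l1 l2 l3 l4 by (simp add: lam0_def)
  ultimately show ?thesis by blast
qed

end

lemma min_mult_integrable: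
  fixes g :: "real \<Rightarrow> real"
  assumes \<eta>: "0 < \<eta>" "\<eta> < 1" and "set_integrable lebesgue {0<..\<eta>} (\<lambda>s. s * g s)"
    and "set_integrable lebesgue {\<eta>..<1} g"
  shows "(\<lambda>s. min s \<eta> * (g s + 1)) integrable_on {0<..<1}"
proof -
  have "(\<lambda>s. min s \<eta> * g s) integrable_on {0<..\<eta>}"
    using integrable_eq[OF set_lebesgue_integral_eq_integral(1)[OF assms(3)], of "\<lambda>s. min s \<eta> * g s"] by simp
  moreover have "(\<lambda>s. min s \<eta> * g s) integrable_on {\<eta>..<1}"
    using integrable_eq[OF integrable_on_mult_right[OF set_lebesgue_integral_eq_integral(1)[OF assms(4)], of \<eta>], of "\<lambda>s. min s \<eta> * g s"] by simp
  moreover have "negligible ({0<..\<eta>} \<inter> {\<eta>..<1})"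
    by (rule negligible_subset[of "{\<eta>}"]) auto
  ultimately have "(\<lambda>s. min s \<eta> * g s) integrable_on ({0<..\<eta>} \<union> {\<eta>..<1})" by (intro integrable_Un)
  moreover have "{0<..\<eta>} \<union> {\<eta>..<1} = {0<..<1}" using \<eta> by auto
  moreover have "(\<lambda>s. min s \<eta>) integrable_on {0<..<1}"
    unfolding integrable_on_open_interval_real by (intro integrable_continuous_interval continuous_intros)
  ultimately have "(\<lambda>s. min s \<eta> * g s + min s \<eta>) integrable_on {0<..<1}" by (intro integrable_add) auto
  then show ?thesis by (simp add: algebra_simps)
qed

theorem theorem2p1:
  fixes f :: "real \<Rightarrow> real \<Rightarrow> real" and g h :: "real \<Rightarrow> real"
    and \<eta> M \<alpha> \<beta> :: real
  assumes eta: "1 / 2 < \<eta>" "\<eta> < 1"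
    and f_cont: "continuous_on ({0<..<1} \<times> {0<..}) (\<lambda>(t, x). f t x)"
    and M_pos: "0 < M"
    and g_pos: "\<And>t. t \<in> {0<..<1} \<Longrightarrow> 0 < g t"
    and g_int_0: "set_integrable lebesgue {0<..\<eta>} (\<lambda>s. s * g s)"
    and g_int_1: "set_integrable lebesgue {\<eta>..<1} g"
    and h_cont: "continuous_on {0<..} h"
    and h_nonneg: "\<And>x. 0 < x \<Longrightarrow> 0 \<le> h x"
    and f_bounds: "\<And>t x. t \<in> {0<..<1} \<Longrightarrow> 0 < x \<Longrightarrow> 0 \<le> M + f t x \<and> M + f t x \<le> g t * h x"
    and alpha_beta: "0 < \<alpha>" "\<alpha> < \<beta>" "\<beta> < 1"
    and lim_0: "uniformly_at_top {\<alpha>..\<beta>} f (at_right 0)"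
    and lim_inf: "uniformly_at_top {\<alpha>..\<beta>} (\<lambda>t x. f t x / x) at_top"
  shows "\<forall>r>0. \<exists>lam0>0. \<forall>lam\<in>{0<..<lam0}.
           \<exists>x y. positive_solution \<eta> lam f x \<and> Ck_on 3 {0<..<1} x \<and>
                 positive_solution \<eta> lam f y \<and> Ck_on 3 {0<..<1} y \<and>
                 0 < norm01 x \<and> norm01 x < r \<and> r < norm01 y"
proof -
  (* Raising M, g and h by 1 makes the nonlinearity M + f bounded below by 1, so that T u never vanishes. *)
  interpret singular_bvp f "\<lambda>t. g t + 1" "\<lambda>x. h x + 1" \<eta> "M + 1" \<alpha> \<beta>
  proof
    show "(\<lambda>s. min s \<eta> * (g s + 1)) integrable_on {0<..<1}"
      using eta g_int_0 g_int_1 by (intro min_mult_integrable) auto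
    show "1 \<le> M + 1 + f t x \<and> M + 1 + f t x \<le> (g t + 1) * (h x + 1)" if "t \<in> {0<..<1}" "0 < x" for t x
      using f_bounds[OF that] g_pos[OF that(1)] h_nonneg[OF that(2)] by (auto simp: algebra_simps)
    show "0 < g t + 1" if "t \<in> {0<..<1}" for t using g_pos[OF that] by simp
  qed (use assms in \<open>auto intro!: continuous_intros\<close>)
  show ?thesis using two_positive_solutions by blast
qed

end
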